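(* Suppose we have a straight array of edge dislocations with Burgers vector $(0,b,0)$, aligned along the $x$-axis over the finite interval $-L^-<x<L^+$ ($L^\pm>0$), whose non-vanishing torsion is $$\tau^2=b\rho\,\delta(y)\bigl(H(x+L^-)-H(x-L^+)\bigr)\,dx\wedge dy ,$$ where $\rho=N/(L^-+L^+)$ is the number density of edge dislocations and $N$ is the number of edge dislocations within the interval. Then a wedge disclination dipole exists at the terminal points of the dislocation array. Moreover, the Frank vectors of the wedge disclinations are $\phi=\pm b\rho$.
   Context: Coordinates on $\mathbb{R}^3$ are $(x,y,z)=(x^1,x^2,x^3)$, the dislocation lines are parallel to the $z$-axis, $\delta$ and $H$ are the Dirac delta and Heaviside step functions, and $\delta(x,y)=\delta(x)\delta(y)$. Plastic deformation field. It is a moving frame (coframe) $\vartheta^i=dx^i+\Theta^i$ with $\Theta^i$ a dual-exact 1-form (the plastic displacement gradient); the Riemannian metric is $g=\delta_{ij}\,\vartheta^i\otimes\vartheta^j$. Metric-compatible connection 1-forms $\omega^i_j=-\omega^j_i$, the torsion $\tau^i$ and the curvature $\Omega^i_j$ are related by Cartan's structure equations $$\tau^i=d\vartheta^i+\omega^i_j\wedge\vartheta^j,\qquad \Omega^i_j=d\omega^i_j+\omega^i_k\wedge\omega^k_j .$$ Dislocations. They are described with the Weitzenböck connection $\omega^i_j=0$, so that $\tau^i=d\vartheta^i$ and $\Omega^i_j=0$; a torsion $\tau^2=b\,\delta(x,y)\,dx\wedge dy$ represents an edge dislocation on the $z$-axis with Burgers vector $(0,b,0)$. The plastic displacement gradient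 is obtained from the dislocation density $\alpha^i=*\tau^i$ (Hodge dual of the torsion) by the Biot--Savart law $\Theta^i(\mathbf{x})=\frac1{4\pi}\int_{\mathbb{R}^3}\frac{\alpha^i(\boldsymbol\xi)\times(\mathbf{x}-\boldsymbol\xi)}{\|\mathbf{x}-\boldsymbol\xi\|^3}\,dV$. Disclinations. They are described with the Levi-Civita connection of the same moving frame (zero torsion): $0=d\vartheta^i+\omega^i_j\wedge\vartheta^j$, $\Omega^i_j=d\omega^i_j+\omega^i_k\wedge\omega^k_j$. Replacing the Weitzenböck connection by the Levi-Civita connection leaves the moving frame and the metric, hence the plastic deformation, unchanged. A wedge disclination with Frank vector $\phi$ (the component along the $z$-axis) on the line over a point $p$ of the $xy$-plane is represented by the curvature $(\Omega^2_3,\Omega^3_1,\Omega^1_2)=\phi\,(0,0,-\delta_p\,dx\wedge dy)$, where $\delta_p$ is the Dirac delta at $p$ in the $xy$-plane. A wedge disclination dipole is a pair of wedge disclinations with opposite Frank vectors. *)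

theory Defs
  imports "HOL-Analysis.Analysis"
begin

unbundle cross3_syntax

text \<open>
  A 1-form is given by its components in \<open>dx\<^sup>1, dx\<^sup>2, dx\<^sup>3\<close>, and a 2-form
  \<open>\<beta>\<^sub>1 dx\<^sup>2\<and>dx\<^sup>3 + \<beta>\<^sub>2 dx\<^sup>3\<and>dx\<^sup>1 + \<beta>\<^sub>3 dx\<^sup>1\<and>dx\<^sup>2\<close> by \<open>(\<beta>\<^sub>1, \<beta>\<^sub>2, \<beta>\<^sub>3)\<close>.  In these components the
  wedge product of 1-forms is the cross product, the exterior derivative of a 1-form is the curl,
  and the Hodge star from 2-forms to 1-forms is the identity.

  A generalised form is a functional on scalar test functions with values in the components.
  Those that get multiplied have (signed) Radon measures as coefficients; they are given as a
  density \<open>u\<close> with respect to a Borel measure \<open>M\<close>, standing for the functional that takes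
  \<open>\<psi>\<close> to the integral of \<open>\<psi> u\<close> against \<open>M\<close>.
\<close>

abbreviation dx :: "3 \<Rightarrow> real^3"
  where "dx i \<equiv> axis i 1"

type_synonym gen_form = "(real^3 \<Rightarrow> real) \<Rightarrow> real^3"


subsection \<open>Test functions and generalised forms\<close>

primrec Ck :: "nat \<Rightarrow> (real^3 \<Rightarrow> real) \<Rightarrow> bool" where
  "Ck 0 f \<longleftrightarrow> continuous_on UNIV f"
| "Ck (Suc k) f \<longleftrightarrow> (\<forall>x. f differentiable at x) \<and>
     (\<forall>v. Ck k (\<lambda>x. frechet_derivative f (at x) v))"

definition test_function :: "(real^3 \<Rightarrow> real) \<Rightarrow> bool"
  where "test_function \<psi> \<longleftrightarrow> (\<forall>k. Ck k \<psi>) \<and> compact (closure {x. \<psi> x \<noteq> 0})"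

definition grad :: "(real^3 \<Rightarrow> real) \<Rightarrow> real^3 \<Rightarrow> real^3"
  where "grad \<psi> x = (\<chi> k. frechet_derivative \<psi> (at x) (axis k 1))"

definition radon_form :: "(real^3) measure \<Rightarrow> (real^3 \<Rightarrow> real^3) \<Rightarrow> bool"
  where "radon_form M u \<longleftrightarrow> sets M = sets borel \<and> (\<forall>K. compact K \<longrightarrow> emeasure M K < \<infinity>) \<and>
    u \<in> borel_measurable borel \<and> (\<forall>K. compact K \<longrightarrow> set_integrable M K u)"

definition gen :: "(real^3) measure \<Rightarrow> (real^3 \<Rightarrow> real^3) \<Rightarrow> gen_form"
  where "gen M u \<psi> = (LINT x|M. \<psi> x *\<^sub>R u x)"

text \<open>The distributional curl: the derivative is moved to the test function.\<close>

definition ext_d :: "(real^3) measure \<Rightarrow> (real^3 \<Rightarrow> real^3) \<Rightarrow> gen_form"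
  where "ext_d M u \<psi> = - (LINT x|M. grad \<psi> x \<times> u x)"


subsection \<open>Products\<close>

text \<open>
  Products of generalised functions are made sense of by regularising with ball averages.  The
  product of a locally integrable function with a measure uses the precise representative of the
  function, that is, the limit of its ball averages (at a jump, the mean of the two sides); the
  product of two measures is the weak limit of the products of their ball averages.
\<close>

definition ball_avg :: "(real^3) measure \<Rightarrow> (real^3 \<Rightarrow> real^3) \<Rightarrow> real \<Rightarrow> real^3 \<Rightarrow> real^3"
  where "ball_avg M u r x = (1 / measure lborel (ball x r)) *\<^sub>R (LINT y:ball x r|M. u y)"

definition precise :: "(real^3 \<Rightarrow> real^3) \<Rightarrow> real^3 \<Rightarrow> real^3"
  where "precise f x = Lim (at_right 0) (\<lambda>r. ball_avg lborel f r x)"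

definition has_precise_value :: "(real^3 \<Rightarrow> real^3) \<Rightarrow> real^3 \<Rightarrow> bool"
  where "has_precise_value f x \<longleftrightarrow> (\<exists>v. ((\<lambda>r. ball_avg lborel f r x) \<longlongrightarrow> v) (at_right 0))"


subsection \<open>Cartan's structure equations\<close>

text \<open>
  \<open>\<theta> i\<close> is the 1-form \<open>\<vartheta>\<^sup>i\<close> of the moving frame, and \<open>\<omega> i j\<close> is the density with respect to \<open>M\<close>
  of the connection form with upper index \<open>i\<close> and lower index \<open>j\<close>.
\<close>

definition has_torsion ::
  "(3 \<Rightarrow> real^3 \<Rightarrow> real^3) \<Rightarrow> (real^3) measure \<Rightarrow> (3 \<Rightarrow> 3 \<Rightarrow> real^3 \<Rightarrow> real^3) \<Rightarrow>
    (3 \<Rightarrow> gen_form) \<Rightarrow> bool"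
  where "has_torsion \<theta> M \<omega> T \<longleftrightarrow>
    (\<forall>i. radon_form lborel (\<theta> i)) \<and> (\<forall>i j. radon_form M (\<omega> i j)) \<and>
    (\<forall>i \<psi>. test_function \<psi> \<longrightarrow>
      has_bochner_integral M (\<lambda>x. \<psi> x *\<^sub>R (\<Sum>j\<in>UNIV. \<omega> i j x \<times> precise (\<theta> j) x))
        (T i \<psi> - ext_d lborel (\<theta> i) \<psi>))"

definition has_curvature ::
  "(real^3) measure \<Rightarrow> (3 \<Rightarrow> 3 \<Rightarrow> real^3 \<Rightarrow> real^3) \<Rightarrow> (3 \<Rightarrow> 3 \<Rightarrow> gen_form) \<Rightarrow> bool"
  where "has_curvature M \<omega> \<Omega> \<longleftrightarrow>
    (\<forall>i j. radon_form M (\<omega> i j)) \<and>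
    (\<forall>i j \<psi>. test_function \<psi> \<longrightarrow>
      ((\<lambda>r. gen lborel (\<lambda>x. \<Sum>k\<in>UNIV. ball_avg M (\<omega> i k) r x \<times> ball_avg M (\<omega> k j) r x) \<psi>)
        \<longlongrightarrow> \<Omega> i j \<psi> - ext_d M (\<omega> i j) \<psi>) (at_right 0))"

definition coframe_at :: "(3 \<Rightarrow> real^3 \<Rightarrow> real^3) \<Rightarrow> real^3 \<Rightarrow> bool"
  where "coframe_at \<theta> x \<longleftrightarrow>
    (\<forall>i. has_precise_value (\<theta> i) x) \<and> det (\<chi> i. precise (\<theta> i) x) \<noteq> 0"

text \<open>
  The forms of a singular moving frame may become linearly dependent, or fail to have a value, on
  a null set (near an end of a dislocation array the logarithmic singularity of the plastic
  displacement gradient forces this).  The structure equations do not determine a connection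
  there, so the Levi-Civita connection is required not to charge that set.
\<close>

definition levi_civita ::
  "(3 \<Rightarrow> real^3 \<Rightarrow> real^3) \<Rightarrow> (real^3) measure \<Rightarrow> (3 \<Rightarrow> 3 \<Rightarrow> real^3 \<Rightarrow> real^3) \<Rightarrow> bool"
  where "levi_civita \<theta> M \<omega> \<longleftrightarrow>
    (AE x in M. \<forall>i j. \<omega> i j x = - \<omega> j i x) \<and>
    has_torsion \<theta> M \<omega> (\<lambda>i \<psi>. 0) \<and>
    (AE x in M. (\<exists>i j. \<omega> i j x \<noteq> 0) \<longrightarrow> coframe_at \<theta> x)"


subsection \<open>Dislocations and disclinations\<close>

definition heaviside :: "real \<Rightarrow> real"
  where "heaviside t = (if t < 0 then 0 else 1)"

text \<open>The generalised functions \<open>\<delta>(y)\<close> and \<open>\<delta>\<^sub>p(x,y)\<close> on three-space, as measures.\<close>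

definition delta_y :: "(real^3) measure"
  where "delta_y = distr (lborel :: (real \<times> real) measure) borel (\<lambda>(x, z). vector [x, 0, z])"

definition delta_line :: "real \<times> real \<Rightarrow> (real^3) measure"
  where "delta_line p = distr (lborel :: real measure) borel (\<lambda>z. vector [fst p, snd p, z])"

definition biot_savart :: "(real^3) measure \<Rightarrow> (real^3 \<Rightarrow> real^3) \<Rightarrow> real^3 \<Rightarrow> real^3"
  where "biot_savart M \<alpha> x =
    (1 / (4 * pi)) *\<^sub>R (LINT \<xi>|M. (1 / norm (x - \<xi>) ^ 3) *\<^sub>R (\<alpha> \<xi> \<times> (x - \<xi>)))"

text \<open>
  The moving frame \<open>\<vartheta>\<^sup>i = dx\<^sup>i + \<Theta>\<^sup>i\<close> of dislocations with torsion densities \<open>\<tau> i\<close> with respect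
  to \<open>M\<close>.  The dislocation density, being the Hodge dual of \<open>\<tau> i\<close>, has the same components.
\<close>

definition plastic_frame ::
  "(real^3) measure \<Rightarrow> (3 \<Rightarrow> real^3 \<Rightarrow> real^3) \<Rightarrow> 3 \<Rightarrow> real^3 \<Rightarrow> real^3"
  where "plastic_frame M \<tau> i x = dx i + biot_savart M (\<tau> i) x"

definition wedge_disclination :: "real \<Rightarrow> real \<times> real \<Rightarrow> 3 \<Rightarrow> 3 \<Rightarrow> gen_form"
  where "wedge_disclination \<phi> p i j =
    (if i = 1 \<and> j = 2 then gen (delta_line p) (\<lambda>_. - \<phi> *\<^sub>R (dx 1 \<times> dx 2))
     else if i = 2 \<and> j = 1 then gen (delta_line p) (\<lambda>_. \<phi> *\<^sub>R (dx 1 \<times> dx 2))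
     else (\<lambda>\<psi>. 0))"

definition wedge_disclination_pair ::
  "real \<Rightarrow> real \<times> real \<Rightarrow> real \<Rightarrow> real \<times> real \<Rightarrow> 3 \<Rightarrow> 3 \<Rightarrow> gen_form"
  where "wedge_disclination_pair \<phi> p \<phi>' q i j \<psi> =
    wedge_disclination \<phi> p i j \<psi> + wedge_disclination \<phi>' q i j \<psi>"

end

theory Submission
  imports Defs
begin

text \<open>
  With \<open>B = b \<rho>\<close>, \<open>q\<^sub>e = ln ((x - e)\<^sup>2 + y\<^sup>2) / 2\<close> and \<open>A\<^sub>e = arctan (y / (x - e))\<close>, the Biot--Savart
  integral gives \<open>\<vartheta>\<^sup>2 = P dx + (1 + Q) dy\<close> off the plane \<open>y = 0\<close>, where \<open>a = -L\<^sup>-\<close>, \<open>c = L\<^sup>+\<close>,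
  \<open>Q = B (q\<^sub>a - q\<^sub>c) / (2 \<pi>)\<close>, and \<open>P = B (A\<^sub>a - A\<^sub>c) / (2 \<pi>)\<close> minus the jump \<open>B sgn y / 2\<close> over the array.
  Since \<open>\<partial>q\<^sub>e/\<partial>x = \<partial>A\<^sub>e/\<partial>y\<close>, only the jump contributes to the curl, which is therefore the prescribed
  torsion.

  On the plane \<open>y = 0\<close> the precise value of \<open>P\<close> vanishes because \<open>P\<close> is odd in \<open>y\<close>.  Hence Cartan's
  equations with zero torsion, which are linear algebra at every point where the forms are
  independent, force \<open>\<omega>\<^sup>1\<^sub>2 = - B (H(x - a) - H(x - c)) \<delta>(y) dy\<close> as the only connection form up to
  antisymmetry.  It satisfies all of them because \<open>1 + Q\<close> has at most one zero on the array.  The quadratic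
  part of the curvature cancels, and \<open>d\<omega>\<^sup>1\<^sub>2\<close> is a pair of opposite Dirac masses at the end points.
\<close>

subsection \<open>Smooth functions and bump functions\<close>

text \<open>The curvature claim concerns connections over an arbitrary Radon measure
  \<open>M\<close>, so neither \<open>M\<close> nor a density can be compared with a given one. Only
  the signed measure with density \<open>g\<close> relative to \<open>M\<close>, where
  \<open>g\<close> is the coefficient of the surviving connection form, is determined; the curl of
  the connection sees nothing else. Torsion is known only against test functions, whereas Cartan's
  linear algebra takes place at points. The passage is a fundamental lemma of the calculus of
  variations for an arbitrary Borel measure, applied to functions of which only the products with
  test functions are known to be integrable. Testing with y \<psi> then confines the torsion to the
  plane y = 0 without any knowledge of \<open>M\<close>. The analytic obstacle lies at the ends of
  the array: the frame is logarithmically singular there and the derivatives of its potentials grow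
  like 1/r. Every use of Fubini and of integration by parts therefore needs an integrable bound, and
  a product of functions of single coordinates provides it.\<close>

definition flat :: "real poly \<Rightarrow> real \<Rightarrow> real"
  where "flat p t = (if t \<le> 0 then 0 else poly p (1 / t) * exp (- (1 / t)))"

lemma poly_div_exp_tendsto_0:
  fixes p :: "real poly"
  shows "((\<lambda>s. poly p s * exp (- s)) \<longlongrightarrow> 0) at_top"
proof -
  have "((\<lambda>s. \<Sum>i\<le>degree p. coeff p i * (s ^ i / exp s)) \<longlongrightarrow> (\<Sum>i\<le>degree p. coeff p i * 0)) at_top"
    by (intro tendsto_intros tendsto_power_div_exp_0)
  then show ?thesis
    by (simp add: poly_altdef sum_distrib_right exp_minus divide_inverse mult.assoc)
qed

lemma flat_tendsto_0: "(flat p \<longlongrightarrow> 0) (at 0)"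
proof -
  have "(flat p \<longlongrightarrow> 0) (at_left 0)"
    by (rule tendsto_eventually) (auto simp: flat_def eventually_at_filter)
  moreover have "(flat p \<longlongrightarrow> 0) (at_right 0)"
  proof -
    have "((\<lambda>t. poly p (inverse t) * exp (- inverse t)) \<longlongrightarrow> 0) (at_right 0)"
      using filterlim_compose[OF poly_div_exp_tendsto_0 filterlim_inverse_at_top_right] .
    then show ?thesis
      by (rule Lim_transform_eventually)
        (auto simp: flat_def eventually_at_filter divide_inverse)
  qed
  ultimately show ?thesis
    by (simp add: filterlim_split_at)
qed

text \<open>The polynomial parameter closes the family under differentiation: the inner derivative
  of 1/t contributes a factor 1/t^2, which is the polynomial X^2 at 1/t, so \<open>p\<close> becomes
  X^2 (p - p').\<close>

lemma flat_has_derivative: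
  "(flat p has_real_derivative flat ([:0, 0, 1:] * (p - pderiv p)) t) (at t)"
proof (cases t "0 :: real" rule: linorder_cases)
  case less
  have "((\<lambda>_. 0) has_real_derivative 0) (at t)" by simp
  then have "(flat p has_real_derivative 0) (at t)"
    by (rule has_field_derivative_transform_within_open[of _ _ _ "{..<0}"]) (use less in \<open>auto simp: flat_def\<close>)
  with less show ?thesis by (simp add: flat_def)
next
  case greater
  have "((\<lambda>t. poly p (1 / t) * exp (- (1 / t))) has_real_derivative
     poly p (1/t) * (exp (-(1/t)) * (1 / t^2)) + poly (pderiv p) (1/t) * (- (1 / t^2)) * exp (-(1/t))) (at t)"
    using greater
    by (auto intro!: derivative_eq_intros DERIV_chain2[OF poly_DERIV] simp: power2_eq_square field_simps)
  then have "(flat p has_real_derivative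
     poly p (1/t) * (exp (-(1/t)) * (1 / t^2)) + poly (pderiv p) (1/t) * (- (1 / t^2)) * exp (-(1/t))) (at t)"
    by (rule has_field_derivative_transform_within_open[of _ _ _ "{0<..}"]) (use greater in \<open>auto simp: flat_def\<close>)
  then show ?thesis
    using greater by (auto simp: flat_def power2_eq_square algebra_simps)
next
  case equal
  \<comment> \<open>At 0 the difference quotient stays in the family: dividing by h replaces
    \<open>p\<close> by X p, that is \<open>pCons 0 p\<close>.\<close>
  have "((\<lambda>h. flat p h / h) \<longlongrightarrow> 0) (at 0)"
    by (rule Lim_transform_eventually[OF flat_tendsto_0[of "pCons 0 p"]])
      (auto simp: flat_def eventually_at_filter)
  then show ?thesis
    using equal by (simp add: DERIV_def flat_def)
qed

text \<open>A class containing all smooth functions and closed under partial derivatives, hence equal to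
  the smooth functions; this yields smoothness of sums and products without a Leibniz formula.\<close>

inductive smooth :: "(real^3 \<Rightarrow> real) \<Rightarrow> bool" where
  smooth_Ck: "(\<And>k. Ck k f) \<Longrightarrow> smooth f"
| smooth_const: "smooth (\<lambda>x. c)"
| smooth_coord: "smooth (\<lambda>x. x $ i)"
| smooth_flat: "smooth (\<lambda>x. flat p (c * x $ i + d))"
| smooth_add: "smooth f \<Longrightarrow> smooth g \<Longrightarrow> smooth (\<lambda>x. f x + g x)"
| smooth_mult: "smooth f \<Longrightarrow> smooth g \<Longrightarrow> smooth (\<lambda>x. f x * g x)"

lemma smooth_has_derivative:
  assumes "smooth f"
  shows "\<exists>f'. (\<forall>x. (f has_derivative f' x) (at x)) \<and> (\<forall>v. smooth (\<lambda>x. f' x v))"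
  using assms
proof induction
  case (smooth_Ck f)
  then have "Ck (Suc k) f" for k by blast
  then have "\<forall>x. (f has_derivative frechet_derivative f (at x)) (at x)"
    and "smooth (\<lambda>x. frechet_derivative f (at x) v)" for v
    by (auto simp flip: frechet_derivative_works intro!: smooth.smooth_Ck)
  then show ?case by (intro exI[of _ "\<lambda>x. frechet_derivative f (at x)"]) auto
next
  case (smooth_const c)
  show ?case
    by (rule exI[of _ "\<lambda>_ _. 0"]) (auto intro: smooth.smooth_const)
next
  case (smooth_coord i)
  have "((\<lambda>x::real^3. x $ i) has_derivative (\<lambda>v. v $ i)) (at x)" for x
    by (rule bounded_linear.has_derivative[OF bounded_linear_vec_nth has_derivative_ident])
  then show ?case
    by (intro exI[of _ "\<lambda>_ v. v $ i"]) (auto intro: smooth.smooth_const)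
next
  case (smooth_flat p c i d)
  let ?q = "[:0, 0, 1:] * (p - pderiv p)"
  have "((\<lambda>x::real^3. flat p (c * x $ i + d)) has_derivative
      (\<lambda>v. flat ?q (c * x $ i + d) * (c * v $ i))) (at x)" for x
  proof -
    have "((\<lambda>x::real^3. c * x $ i + d) has_derivative (\<lambda>v. c * v $ i)) (at x)"
      by (auto intro!: derivative_eq_intros bounded_linear.has_derivative[OF bounded_linear_vec_nth has_derivative_ident])
    from has_derivative_compose[OF this flat_has_derivative[of p, THEN has_field_derivative_imp_has_derivative]]
    show ?thesis by simp
  qed
  then show ?case
    by (intro exI[of _ "\<lambda>x v. flat ?q (c * x $ i + d) * (c * v $ i)"])
      (simp add: smooth.smooth_const smooth.smooth_mult smooth.smooth_flat)
next
  case (smooth_add f g)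
  then obtain f' g' where "\<forall>x. (f has_derivative f' x) (at x)" "\<forall>x. (g has_derivative g' x) (at x)"
    and "\<forall>v. smooth (\<lambda>x. f' x v)" "\<forall>v. smooth (\<lambda>x. g' x v)" by blast
  then show ?case
    by (intro exI[of _ "\<lambda>x v. f' x v + g' x v"]) (simp add: smooth.smooth_add has_derivative_add)
next
  case (smooth_mult f g)
  then obtain f' g' where "\<forall>x. (f has_derivative f' x) (at x)" "\<forall>x. (g has_derivative g' x) (at x)"
    and "\<forall>v. smooth (\<lambda>x. f' x v)" "\<forall>v. smooth (\<lambda>x. g' x v)" by blast
  with smooth_mult show ?case
    by (intro exI[of _ "\<lambda>x v. f x * g' x v + f' x v * g x"])
      (simp add: smooth.smooth_add smooth.smooth_mult has_derivative_mult)
qed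

text \<open>The induction on \<open>k\<close> only uses that a member of the class has a derivative
  whose directional values are members again, so no higher derivative is ever expanded.\<close>

lemma smooth_imp_Ck: "smooth f \<Longrightarrow> Ck k f"
proof (induction k arbitrary: f)
  case 0
  then obtain f' where "\<forall>x. (f has_derivative f' x) (at x)"
    using smooth_has_derivative by blast
  then show ?case
    by (auto intro!: continuous_at_imp_continuous_on has_derivative_continuous)
next
  case (Suc k)
  then obtain f' where f': "\<And>x. (f has_derivative f' x) (at x)" "\<And>v. smooth (\<lambda>x. f' x v)"
    using smooth_has_derivative by blast
  have "frechet_derivative f (at x) = f' x" for x
    using frechet_derivative_at[OF f'(1)] by simp
  with Suc.IH f' show ?case
    by (auto simp: differentiable_def)
qed

lemma smooth_iff_Ck: "smooth f \<longleftrightarrow> (\<forall>k. Ck k f)"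
  by (rule iffI) (simp_all add: smooth_imp_Ck smooth_Ck)

lemma smooth_power: "smooth f \<Longrightarrow> smooth (\<lambda>x. f x ^ n)"
  by (induction n) (simp_all add: smooth_const smooth_mult)

lemma smooth_prod: "finite I \<Longrightarrow> (\<And>i. i \<in> I \<Longrightarrow> smooth (f i)) \<Longrightarrow> smooth (\<lambda>x. \<Prod>i\<in>I. f i x)"
  by (induction I rule: finite_induct) (simp_all add: smooth_const smooth_mult)

lemma test_function_subset:
  assumes "smooth f" "{x. f x \<noteq> 0} \<subseteq> K" "compact K"
  shows "test_function f"
proof -
  have "closure {x. f x \<noteq> 0} \<subseteq> K"
    using assms by (simp add: closure_minimal compact_imp_closed)
  then have "compact (closure {x. f x \<noteq> 0})"
    using compact_Int_closed[OF assms(3) closed_closure, of "{x. f x \<noteq> 0}"] by (simp add: inf_absorb2)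
  with assms(1) show ?thesis by (simp add: test_function_def smooth_iff_Ck)
qed

lemma test_function_smooth: "test_function f \<Longrightarrow> smooth f"
  by (simp add: test_function_def smooth_iff_Ck)

lemma test_function_mult:
  assumes "test_function f" "smooth g"
  shows "test_function (\<lambda>x. g x * f x)"
proof (rule test_function_subset)
  show "smooth (\<lambda>x. g x * f x)"
    using assms by (simp add: smooth_mult test_function_smooth)
  show "{x. g x * f x \<noteq> 0} \<subseteq> closure {x. f x \<noteq> 0}"
    using closure_subset[of "{x. f x \<noteq> 0}"] by auto
  show "compact (closure {x. f x \<noteq> 0})"
    using assms(1) by (simp add: test_function_def)
qed

lemma test_function_differentiable:
  assumes "test_function f"
  shows "(f has_derivative frechet_derivative f (at x)) (at x)"
proof -
  obtain f' where "(f has_derivative f' x) (at x)"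
    using smooth_has_derivative[OF test_function_smooth[OF assms]] by blast
  then show ?thesis by (simp add: frechet_derivative_works[symmetric] differentiableI)
qed

text \<open>Off the closed support the function vanishes on an open set, hence so does its
  derivative; the support therefore does not grow.\<close>

lemma test_function_derivative:
  assumes "test_function f"
  shows "test_function (\<lambda>x. frechet_derivative f (at x) v)"
proof (rule test_function_subset[of _ "closure {x. f x \<noteq> 0}"])
  have "Ck (Suc k) f" for k using assms by (simp add: test_function_def)
  then show "smooth (\<lambda>x. frechet_derivative f (at x) v)" by (auto intro!: smooth_Ck)
  show "compact (closure {x. f x \<noteq> 0})" using assms by (simp add: test_function_def)
  show "{x. frechet_derivative f (at x) v \<noteq> 0} \<subseteq> closure {x. f x \<noteq> 0}"
  proof clarify
    fix x assume nz: "frechet_derivative f (at x) v \<noteq> 0"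
    show "x \<in> closure {x. f x \<noteq> 0}"
    proof (rule ccontr)
      assume x: "x \<notin> closure {x. f x \<noteq> 0}"
      have "((\<lambda>_. 0) has_derivative (\<lambda>_. 0)) (at x within UNIV)" by simp
      then have "(f has_derivative (\<lambda>_. 0)) (at x within UNIV)"
        by (rule has_derivative_transform_within_open[where s = "- closure {x. f x \<noteq> 0}"])
          (use x closure_subset[of "{x. f x \<noteq> 0}"] in auto)
      then have "frechet_derivative f (at x) = (\<lambda>_. 0)"
        using frechet_derivative_at by metis
      with nz show False by simp
    qed
  qed
qed

lemma test_function_bound:
  assumes "test_function f"
  obtains R where "R > 0" "\<And>x. f x \<noteq> 0 \<Longrightarrow> norm x < R"
proof -
  have "bounded (closure {x. f x \<noteq> 0})"
    using assms by (simp add: test_function_def compact_imp_bounded)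
  then obtain R where "R > 0" "\<forall>x\<in>closure {x. f x \<noteq> 0}. norm x \<le> R"
    by (auto simp: bounded_pos)
  with that[of "R + 1"] closure_subset[of "{x. f x \<noteq> 0}"] show ?thesis by fastforce
qed

lemma test_function_continuous: "test_function f \<Longrightarrow> continuous_on S f"
  using continuous_on_subset[of UNIV f S] by (auto simp: test_function_def dest: spec[of _ 0])

lemma test_function_borel [measurable_dest]: "test_function f \<Longrightarrow> f \<in> borel_measurable borel"
  using borel_measurable_continuous_onI test_function_continuous by blast

text \<open>Positivity exactly on the open box and the bound 1 together make (1 - \<psi>)^n tend to
  0 on the box while it stays 1 elsewhere.\<close>

lemma bump_function:
  fixes l u :: "real^3"
  obtains \<psi> where "test_function \<psi>" "\<And>x. 0 \<le> \<psi> x" "\<And>x. \<psi> x \<le> 1" "\<And>x. \<psi> x > 0 \<longleftrightarrow> x \<in> box l u"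
proof
  define h where "h = (\<lambda>i (x::real^3). flat 1 (x $ i - l $ i) * flat 1 (u $ i - x $ i))"
  have flat: "0 \<le> flat 1 t" "flat 1 t \<le> 1" "flat 1 t > 0 \<longleftrightarrow> t > 0" for t
    by (auto simp: flat_def)
  let ?\<psi> = "\<lambda>x. \<Prod>i\<in>UNIV. h i x"
  have nonneg: "0 \<le> h i x" and le: "h i x \<le> 1" for i x
    using flat by (auto simp: h_def intro: mult_le_one)
  have pos: "h i x > 0 \<longleftrightarrow> l $ i < x $ i \<and> x $ i < u $ i" for i x
    unfolding h_def using flat(1,3)[of "x $ i - l $ i"] flat(1,3)[of "u $ i - x $ i"]
    by (auto simp: zero_less_mult_iff)
  show "0 \<le> ?\<psi> x" for x using nonneg by (simp add: prod_nonneg)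
  show "?\<psi> x \<le> 1" for x using nonneg le by (simp add: prod_le_1)
  show box: "?\<psi> x > 0 \<longleftrightarrow> x \<in> box l u" for x
  proof -
    have "?\<psi> x > 0 \<longleftrightarrow> (\<forall>i. h i x > 0)"
      using nonneg[of _ x] by (auto simp: less_le prod_nonneg)
    then show ?thesis by (simp add: pos mem_box_cart)
  qed
  have "smooth (h i)" for i
    using smooth_mult[OF smooth_flat[of 1 1 i "- l $ i"] smooth_flat[of 1 "-1" i "u $ i"]]
    by (simp add: h_def algebra_simps)
  then have "smooth ?\<psi>" by (intro smooth_prod) auto
  moreover have "{x. ?\<psi> x \<noteq> 0} \<subseteq> cbox l u"
    using box \<open>\<And>x. 0 \<le> ?\<psi> x\<close> box_subset_cbox[of l u] by (force simp: less_le)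
  ultimately show "test_function ?\<psi>"
    by (rule test_function_subset) auto
qed

text \<open>If \<open>\<psi>\<close> is a bump on a box with values in \<open>[0, 1]\<close>, the test functions \<open>1 - (1 - \<psi>) ^ n\<close> increase to
  the indicator of the box.\<close>

lemma AE_zero_if_test_integrals_zero:
  fixes G :: "real^3 \<Rightarrow> real"
  assumes sets: "sets M = sets borel" and G: "integrable M G"
    and zero: "\<And>\<psi>. test_function \<psi> \<Longrightarrow> (LINT x|M. \<psi> x * G x) = 0"
  shows "AE x in M. G x = 0"
proof -
  note [measurable_cong] = sets
  have [simp]: "space M = UNIV" using sets_eq_imp_space_eq[OF sets] by simp
  have [measurable]: "G \<in> borel_measurable M" using G by simp
  have box_zero: "(LINT x:box l u|M. G x) = 0" for l u :: "real^3"
  proof -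
    obtain \<psi> where \<psi>: "test_function \<psi>" "\<And>x. 0 \<le> \<psi> x" "\<And>x. \<psi> x \<le> 1" "\<And>x. \<psi> x > 0 \<longleftrightarrow> x \<in> box l u"
      by (rule bump_function[of l u]) blast
    have [measurable]: "\<psi> \<in> borel_measurable borel" by (rule test_function_borel[OF \<psi>(1)])
    define f where "f = (\<lambda>n x. 1 - (1 - \<psi> x) ^ n)"
    have "(LINT x|M. f n x * G x) = 0" for n
    proof (rule zero)
      obtain R where R: "\<And>x. \<psi> x \<noteq> 0 \<Longrightarrow> norm x < R" using test_function_bound[OF \<psi>(1)] by blast
      \<comment> \<open>The difference is spelled with sums and products because these are the
        closure rules of \<open>smooth\<close>.\<close>
      have "smooth (\<lambda>x. 1 + (-1) * (1 + (-1) * \<psi> x) ^ n)"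
        using test_function_smooth[OF \<psi>(1)] by (simp only: smooth_add smooth_mult smooth_const smooth_power)
      then show "test_function (f n)"
        by (intro test_function_subset[of _ "cball 0 R"]) (auto simp: f_def intro!: less_imp_le[OF R])
    qed
    moreover have "(\<lambda>n. LINT x|M. f n x * G x) \<longlonglongrightarrow> (LINT x|M. indicator (box l u) x * G x)"
    proof (rule integral_dominated_convergence[where w = "\<lambda>x. norm (G x)"])
      show "integrable M (\<lambda>x. norm (G x))" using G by simp
      show "AE x in M. (\<lambda>n. f n x * G x) \<longlonglongrightarrow> indicator (box l u) x * G x"
      proof (rule AE_I2)
        fix x
        have "(\<lambda>n. f n x) \<longlonglongrightarrow> indicator (box l u) x"
        proof (cases "x \<in> box l u")
          case True
          then have "\<bar>1 - \<psi> x\<bar> < 1" using \<psi>(3)[of x] \<psi>(4)[of x] by auto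
          then have "(\<lambda>n. (1 - \<psi> x) ^ n) \<longlonglongrightarrow> 0" by (rule LIMSEQ_abs_realpow_zero2)
          from tendsto_diff[OF tendsto_const[of 1] this] show ?thesis using True by (simp add: f_def)
        next
          case False
          then have "\<psi> x = 0" using \<psi>(2)[of x] \<psi>(4)[of x] by auto
          then show ?thesis using False by (simp add: f_def)
        qed
        then show "(\<lambda>n. f n x * G x) \<longlonglongrightarrow> indicator (box l u) x * G x" by (rule tendsto_mult_right)
      qed
      show "AE x in M. norm (f n x * G x) \<le> norm (G x)" for n
      proof (rule AE_I2)
        fix x
        have "0 \<le> 1 - \<psi> x" "1 - \<psi> x \<le> 1" using \<psi>(2,3)[of x] by auto
        then have "0 \<le> (1 - \<psi> x) ^ n" "(1 - \<psi> x) ^ n \<le> 1" by (auto intro: power_le_one)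
        then have "\<bar>f n x\<bar> \<le> 1" by (auto simp: f_def)
        then show "norm (f n x * G x) \<le> norm (G x)" by (simp add: abs_mult mult_left_le_one_le)
      qed
    qed (simp_all add: f_def)
    ultimately have "(LINT x|M. indicator (box l u) x * G x) = 0"
      using LIMSEQ_unique[OF _ tendsto_const[of 0]] by simp
    then show ?thesis by (simp add: set_lebesgue_integral_def)
  qed
  have setint: "set_integrable M A G" if "A \<in> sets borel" for A
    unfolding set_integrable_def using that sets G by (intro integrable_mult_indicator) auto
  \<comment> \<open>The complement step of the Dynkin induction below needs the integral over the
    whole space, which is not a bounded box; growing boxes exhaust it.\<close>
  have total: "(LINT x|M. G x) = 0"
  proof -
    let ?A = "\<lambda>n::nat. box (- (\<chi> i. real n)) (\<chi> i. real n) :: (real^3) set"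
    have "(\<lambda>n. LINT x|M. indicator (?A n) x *\<^sub>R G x) \<longlonglongrightarrow> (LINT x|M. G x)"
    proof (rule integral_dominated_convergence[where w = "\<lambda>x. norm (G x)"])
      show "AE x in M. (\<lambda>n. indicator (?A n) x *\<^sub>R G x) \<longlonglongrightarrow> G x"
      proof (rule AE_I2)
        fix x :: "real^3"
        obtain m where m: "norm x < real m" using reals_Archimedean2 by blast
        have "x \<in> ?A n" if "n \<ge> m" for n
        proof -
          have "\<bar>x $ i\<bar> < real n" for i
            using component_le_norm_cart[of x i] m that by linarith
          then show ?thesis by (auto simp: mem_box_cart abs_less_iff minus_less_iff)
        qed
        then show "(\<lambda>n. indicator (?A n) x *\<^sub>R G x) \<longlonglongrightarrow> G x"
          by (intro tendsto_eventually eventually_sequentiallyI[of m]) simp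
      qed
    qed (use G in \<open>auto simp: indicator_def\<close>)
    then show ?thesis
      using box_zero LIMSEQ_unique[OF _ tendsto_const[of 0]]
      by (simp add: set_lebesgue_integral_def)
  qed
  have sets_box: "sets borel = sigma_sets UNIV (range (\<lambda>(a, b). box a b :: (real^3) set))"
    by (subst borel_eq_box) (simp add: sets_measure_of)
  have "(LINT x:A|M. G x) = 0" if "A \<in> sets M" for A
  proof -
    have A: "A \<in> sigma_sets UNIV (range (\<lambda>(a, b). box a b :: (real^3) set))"
      using that sets sets_box by simp
    have stable: "Int_stable (range (\<lambda>(a, b). box a b :: (real^3) set))"
      by (auto simp: Int_stable_def box_Int_box)
    have borel: "B \<in> sets borel"
      if "B \<in> sigma_sets UNIV (range (\<lambda>(a, b). box a b :: (real^3) set))" for B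
      using that sets_box by simp
    from stable subset_UNIV[of "range (\<lambda>(a, b). box a b :: (real^3) set)", folded Pow_UNIV] A show ?thesis
    proof (induction rule: sigma_sets_induct_disjoint)
      case (compl B)
      have "(LINT x:UNIV|M. G x) = (LINT x:B|M. G x) + (LINT x:UNIV - B|M. G x)"
        using set_integral_Un[of B "UNIV - B" M G] setint borel[OF compl(1)] by (simp add: Un_Diff_cancel)
      with compl total show ?case by (simp add: set_lebesgue_integral_def)
    next
      case (union B)
      have "(LINT x:\<Union>(range B)|M. G x) = (\<Sum>i. LINT x:B i|M. G x)"
      proof (rule lebesgue_integral_countable_add)
        have "B i \<in> sets borel" for i using union(2) borel by blast
        then show "B i \<in> sets M" "set_integrable M (\<Union>(range B)) G" for i
          by (auto simp: sets intro!: setint)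
      qed (use union(1) in \<open>auto simp: disjoint_family_on_def\<close>)
      with union show ?case by simp
    next
      case empty
      show ?case by (simp add: set_lebesgue_integral_def)
    qed (auto simp: box_zero)
  qed
  then have "AE x in M. G x = (\<lambda>_. 0) x"
    by (intro density_unique_real G) (auto simp: set_lebesgue_integral_def)
  then show ?thesis by simp
qed

text \<open>\<open>F\<close> itself need not be integrable. A bump \<psi> that is positive on a
  large box makes \<psi> F integrable, and \<eta> \<psi> is a test function for every test function
  \<eta>, so \<psi> F vanishes almost everywhere. Countably many boxes cover the space.\<close>

lemma AE_zero_if_weakly_zero:
  fixes F :: "real^3 \<Rightarrow> real"
  assumes sets: "sets M = sets borel"
    and zero: "\<And>\<psi>. test_function \<psi> \<Longrightarrow> has_bochner_integral M (\<lambda>x. \<psi> x * F x) 0"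
  shows "AE x in M. F x = 0"
proof -
  have "AE x in M. norm x < real n \<longrightarrow> F x = 0" for n
  proof -
    obtain \<psi> where \<psi>: "test_function \<psi>"
      "\<And>x. \<psi> x > 0 \<longleftrightarrow> x \<in> box (- (\<chi> i. real n)) (\<chi> i. real n :: real^3)"
      by (rule bump_function[of "- (\<chi> i. real n)" "(\<chi> i. real n)"]) blast
    have "AE x in M. \<psi> x * F x = 0"
    proof (rule AE_zero_if_test_integrals_zero[OF sets])
      show "integrable M (\<lambda>x. \<psi> x * F x)" using zero[OF \<psi>(1)] by (rule integrable.intros)
      fix \<eta> assume "test_function \<eta>"
      from zero[OF test_function_mult[OF this test_function_smooth[OF \<psi>(1)]]]
      show "(LINT x|M. \<eta> x * (\<psi> x * F x)) = 0"
        by (simp add: has_bochner_integral_iff ac_simps)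
    qed
    then show ?thesis
    proof (rule eventually_mono)
      fix x assume x: "\<psi> x * F x = 0"
      show "norm x < real n \<longrightarrow> F x = 0"
      proof
        assume n: "norm x < real n"
        have "\<bar>x $ i\<bar> < real n" for i
          using component_le_norm_cart[of x i] n by linarith
        then have "x \<in> box (- (\<chi> i. real n)) (\<chi> i. real n)"
          by (auto simp: mem_box_cart abs_less_iff minus_less_iff)
        with \<psi>(2)[of x] x show "F x = 0" by auto
      qed
    qed
  qed
  then have "AE x in M. \<forall>n. norm x < real n \<longrightarrow> F x = 0" by (subst AE_all_countable) blast
  then show ?thesis
    by (rule eventually_mono) (meson reals_Archimedean2)
qed

subsection \<open>Integration on three-space\<close>

lemma vector3_eq: "vector [x, y, z] = x *\<^sub>R axis 1 1 + y *\<^sub>R axis 2 1 + z *\<^sub>R (axis 3 1 :: real^3)"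
  by (simp add: vec_eq_iff forall_3 axis_def)

lemma measurable_vec_nth [measurable]: "(\<lambda>x::real^'n. x $ i) \<in> borel_measurable borel"
  by (intro borel_measurable_continuous_onI continuous_intros)

lemma emeasure_lborel_Times:
  fixes A :: "'a::euclidean_space set" and B :: "'b::euclidean_space set"
  assumes "A \<in> sets borel" "B \<in> sets borel"
  shows "emeasure lborel (Sigma A (\<lambda>_. B)) = emeasure lborel A * emeasure lborel B"
  using assms by (simp add: lborel_prod[symmetric] lborel.emeasure_pair_measure_Times)

lemma integrable_indicator_Icc: "integrable lborel (indicator {a..b::real} :: real \<Rightarrow> real)"
  by (simp add: emeasure_lborel_Icc_eq)

text \<open>Both measures agree on boxes. The three axes may come in any order so that Fubini can
  make any chosen coordinate the innermost one, which is what integration by parts in that direction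
  requires.\<close>

lemma lborel_cart3:
  fixes p q r :: 3
  assumes "distinct [p, q, r]"
  shows "(lborel :: (real^3) measure) = distr (lborel :: (real \<times> real \<times> real) measure) borel
    (\<lambda>(a, b, c). a *\<^sub>R axis p 1 + b *\<^sub>R axis q 1 + c *\<^sub>R axis r 1)" (is "_ = distr _ _ ?T")
proof (rule lborel_eqI)
  have [measurable]: "?T \<in> borel_measurable borel" by (simp add: borel_prod[symmetric])
  have UNIV: "UNIV = {p, q, r}"
    using assms by (intro card_subset_eq[symmetric]) auto
  have all: "(\<forall>i. P i) \<longleftrightarrow> P p \<and> P q \<and> P r" for P
    using UNIV by (metis UNIV_I insertE singletonD)
  fix l u :: "real^3"
  assume le: "\<And>b. b \<in> Basis \<Longrightarrow> l \<bullet> b \<le> u \<bullet> b"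
  have le': "l $ i \<le> u $ i" for i
    using le[of "axis i 1"] by (simp add: inner_axis axis_in_Basis_iff)
  have axis: "axis q 1 $ p = (0::real)" "axis r 1 $ p = (0::real)" "axis p 1 $ q = (0::real)"
    "axis r 1 $ q = (0::real)" "axis p 1 $ r = (0::real)" "axis q 1 $ r = (0::real)"
    using assms by (auto simp: axis_def)
  let ?B = "\<lambda>i. box (l $ i) (u $ i)"
  have "?T -` box l u = Sigma (?B p) (\<lambda>_. Sigma (?B q) (\<lambda>_. ?B r))"
    by (auto simp: mem_box_cart all box_real axis)
  moreover have "emeasure lborel (Sigma (?B p) (\<lambda>_. Sigma (?B q) (\<lambda>_. ?B r))) =
      ennreal ((u $ p - l $ p) * ((u $ q - l $ q) * (u $ r - l $ r)))"
    by (simp add: emeasure_lborel_Times le' ennreal_mult box_real borel_prod[symmetric] pair_measureI)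
  moreover have "(\<Prod>b\<in>Basis. (u - l) \<bullet> b) = (\<Prod>i\<in>UNIV. u $ i - l $ i)"
  proof -
    have "(Basis :: (real^3) set) = (\<lambda>i. axis i 1) ` UNIV" by (auto simp: Basis_vec_def)
    moreover have "inj (\<lambda>i::3. axis i (1::real))" by (auto simp: inj_on_def axis_eq_axis)
    ultimately have "(\<Prod>b\<in>Basis. (u - l) \<bullet> b) = (\<Prod>i\<in>UNIV. (u - l) \<bullet> axis i 1)"
      by (metis (no_types, lifting) prod.reindex_cong)
    then show ?thesis by (simp add: inner_axis)
  qed
  ultimately show "emeasure (distr lborel borel ?T) (box l u) = (\<Prod>b\<in>Basis. (u - l) \<bullet> b)"
    using assms by (simp add: emeasure_distr UNIV mult.assoc)
qed simp

lemma integral_slice: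
  fixes f :: "real^3 \<Rightarrow> 'a::{banach, second_countable_topology}" and p q r :: 3
  assumes "distinct [p, q, r]" and f: "integrable lborel f"
  shows "(LINT x|lborel. f x) = (LINT (b, c)|lborel. LINT a|lborel. f (a *\<^sub>R axis p 1 + b *\<^sub>R axis q 1 + c *\<^sub>R axis r 1))"
proof -
  let ?T = "\<lambda>(a, b, c). a *\<^sub>R axis p 1 + b *\<^sub>R axis q 1 + c *\<^sub>R axis r (1::real)"
  have T [measurable]: "?T \<in> borel_measurable borel" by (simp add: borel_prod[symmetric])
  have [measurable]: "f \<in> borel_measurable borel" using f by auto
  have "integrable lborel (\<lambda>x. f (?T x))"
    using f unfolding lborel_cart3[OF assms(1)] by (subst (asm) integrable_distr_eq) auto
  then have "integrable (lborel \<Otimes>\<^sub>M lborel) (\<lambda>(a, bc). f (?T (a, bc)))"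
    by (simp add: lborel_prod case_prod_unfold)
  from lborel_pair.integral_snd[OF this]
  have "(LINT x|lborel. f (?T x)) = (LINT bc|lborel. LINT a|lborel. f (?T (a, bc)))"
    by (simp add: lborel_prod case_prod_unfold)
  moreover have "(LINT x|lborel. f x) = (LINT x|lborel. f (?T x))"
    unfolding lborel_cart3[OF assms(1)] by (subst integral_distr) auto
  ultimately show ?thesis by (simp add: case_prod_unfold)
qed

lemma
  fixes f :: "real^3 \<Rightarrow> 'a::{banach, second_countable_topology}"
  assumes f: "integrable lborel f"
  shows integral_slice_1: "(LINT x|lborel. f x) = (LINT (y, z)|lborel. LINT x|lborel. f (vector [x, y, z]))"
    and integral_slice_2: "(LINT x|lborel. f x) = (LINT (x, z)|lborel. LINT y|lborel. f (vector [x, y, z]))"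
    and integral_slice_3: "(LINT x|lborel. f x) = (LINT (x, y)|lborel. LINT z|lborel. f (vector [x, y, z]))"
  using integral_slice[OF _ f, of 1 2 3] integral_slice[OF _ f, of 2 1 3] integral_slice[OF _ f, of 3 1 2]
  by (simp_all add: vector3_eq algebra_simps)

lemma integrable_times_pair:
  fixes f :: "'a::euclidean_space \<Rightarrow> real" and g :: "'b::euclidean_space \<Rightarrow> real"
  assumes f: "integrable lborel f" and g: "integrable lborel g"
  shows "integrable lborel (\<lambda>(x, y). f x * g y)"
proof -
  have [measurable]: "f \<in> borel_measurable borel" "g \<in> borel_measurable borel" using f g by auto
  have "integrable (lborel \<Otimes>\<^sub>M lborel) (\<lambda>(x, y). f x * g y)"
    by (rule lborel_pair.Fubini_integrable) (use f g in \<open>auto simp: abs_mult\<close>)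
  then show ?thesis by (simp add: lborel_prod)
qed

lemma integrable_times_vec3:
  fixes f g h :: "real \<Rightarrow> real"
  assumes "integrable lborel f" "integrable lborel g" "integrable lborel h"
  shows "integrable lborel (\<lambda>x::real^3. f (x $ 1) * (g (x $ 2) * h (x $ 3)))"
proof -
  have [measurable]: "f \<in> borel_measurable borel" "g \<in> borel_measurable borel" "h \<in> borel_measurable borel"
    using assms by auto
  let ?T = "\<lambda>(a, b, c). a *\<^sub>R axis 1 1 + b *\<^sub>R axis 2 1 + c *\<^sub>R axis 3 (1::real) :: real^3"
  have [measurable]: "?T \<in> borel_measurable borel" by (simp add: borel_prod[symmetric])
  have "integrable lborel (\<lambda>(x, yz). f x * (case yz of (y, z) \<Rightarrow> g y * h z))"
    by (intro integrable_times_pair assms)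
  then have "integrable lborel (\<lambda>x. f (?T x $ 1) * (g (?T x $ 2) * h (?T x $ 3)))"
    by (simp add: case_prod_unfold axis_def)
  then show ?thesis
    by (subst lborel_cart3[of 1 2 3]) (simp_all add: integrable_distr_eq)
qed

text \<open>Dominates both the logarithm and the kernel \<open>1/r\<close> of the plane by products of functions of one
  variable.\<close>

definition weight :: "real \<Rightarrow> real"
  where "weight t = 1 + \<bar>t\<bar> powr (- 1 / 2)"

lemma weight_ge_1: "1 \<le> weight t" by (simp add: weight_def)

lemma weight_borel [measurable]: "weight \<in> borel_measurable borel"
  unfolding weight_def[abs_def] by measurable

lemma integrable_weight: "integrable lborel (\<lambda>t. indicator {- R..R} t * weight (t - a))"
proof -
  \<comment> \<open>The translation by \<open>a\<close> maps [-R, R] into [-S, S].\<close>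
  define S where "S = \<bar>R\<bar> + \<bar>a\<bar>"
  have half: "integrable lborel (\<lambda>t. indicator {0..S} t * t powr (- 1 / 2))"
  proof -
    have "(\<lambda>t. t powr (- 1 / 2)) integrable_on {0..S}"
      using has_integral_powr_from_0[of "- 1 / 2" S] by (auto simp: S_def)
    then have "(\<lambda>t. t powr (- 1 / 2)) absolutely_integrable_on {0..S}"
      by (intro nonnegative_absolutely_integrable_1) auto
    then show ?thesis
      by (simp add: set_integrable_def integrable_completion)
  qed
  have "integrable lborel (\<lambda>t. indicator {0..S} (0 + (-1) * t) * (0 + (-1) * t) powr (- 1 / 2))"
    by (rule lborel_integrable_real_affine[OF half]) simp
  moreover have "(\<lambda>t. indicator {- S..S} t * \<bar>t\<bar> powr (- 1 / 2)) =
      (\<lambda>t. indicator {0..S} t * t powr (- 1 / 2) + indicator {0..S} (0 + (-1) * t) * (0 + (-1) * t) powr (- 1 / 2))"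
    by (auto simp: fun_eq_iff indicator_def)
  ultimately have sym: "integrable lborel (\<lambda>t. indicator {- S..S} t * \<bar>t\<bar> powr (- 1 / 2))"
    using half by simp
  have "integrable lborel (\<lambda>t. indicator {- S..S} t * (1::real))"
    using integrable_indicator_Icc by simp
  from Bochner_Integration.integrable_add[OF this sym]
  have "integrable lborel (\<lambda>t. indicator {- S..S} t * weight t)"
    by (simp add: weight_def algebra_simps)
  from lborel_integrable_real_affine[OF this, of 1 "- a"]
  have "integrable lborel (\<lambda>t. indicator {- S..S} (t - a) * weight (t - a))" by simp
  then show ?thesis
    by (rule Bochner_Integration.integrable_bound)
      (use weight_ge_1 in \<open>auto simp: indicator_def S_def intro: order_trans[OF zero_le_one]\<close>)
qed

lemma AE_lborel_nth_neq: "AE x in lborel. (x::real^'n) $ i \<noteq> c"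
proof -
  have "{x::real^'n. x $ i = c} \<in> null_sets lebesgue"
    using negligible_standard_hyperplane[of "axis i (1::real)" c]
    by (simp add: negligible_iff_null_sets inner_axis axis_in_Basis_iff)
  then have "{x::real^'n. x $ i = c} \<in> null_sets lborel"
    by (rule null_sets_completion_iff[THEN iffD1, rotated]) simp
  from AE_not_in[OF this] show ?thesis by simp
qed

lemma weighted_integrable:
  fixes \<psi> u :: "real^3 \<Rightarrow> real"
  assumes [measurable]: "\<psi> \<in> borel_measurable borel" "u \<in> borel_measurable borel"
    and \<psi>: "\<And>x. \<bar>\<psi> x\<bar> \<le> C" "\<And>x. \<psi> x \<noteq> 0 \<Longrightarrow> norm x < R"
    and u: "\<And>x. norm x < R \<Longrightarrow> x $ 1 \<noteq> a \<Longrightarrow> x $ 2 \<noteq> 0 \<Longrightarrow> \<bar>u x\<bar> \<le> D * (weight (x $ 1 - a) * weight (x $ 2))"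
  shows "integrable lborel (\<lambda>x. \<psi> x * u x)"
proof (rule Bochner_Integration.integrable_bound)
  let ?I = "indicator {- R..R} :: real \<Rightarrow> real"
  let ?b = "\<lambda>x::real^3. C * D * ((?I (x $ 1) * weight (x $ 1 - a)) * ((?I (x $ 2) * weight (x $ 2 - 0)) * ?I (x $ 3)))"
  show "integrable lborel ?b"
    by (intro integrable_mult_right integrable_times_vec3 integrable_weight integrable_indicator_Icc)
  have "0 \<le> C" using \<psi>(1)[of 0] by linarith
  show "AE x in lborel. norm (\<psi> x * u x) \<le> norm (?b x)"
    using AE_lborel_nth_neq[of 1 a] AE_lborel_nth_neq[of 2 0]
  proof eventually_elim
    case (elim x)
    show ?case
    proof (cases "\<psi> x = 0")
      case False
      then have R: "norm x < R" by (rule \<psi>(2))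
      have "\<bar>x $ i\<bar> \<le> R" for i
        using component_le_norm_cart[of x i] R by linarith
      then have "?I (x $ i) = 1" for i by (auto simp: abs_le_iff minus_le_iff)
      moreover have "\<bar>\<psi> x * u x\<bar> \<le> C * (D * (weight (x $ 1 - a) * weight (x $ 2)))"
        unfolding abs_mult using \<psi>(1) u[OF R elim] \<open>0 \<le> C\<close> by (intro mult_mono) auto
      ultimately show ?thesis by (simp add: mult.assoc)
    qed simp
  qed
qed simp

subsection \<open>Integration by parts against test functions\<close>

lemma integral_derivative_compact_support:
  fixes F f :: "real \<Rightarrow> real"
  assumes F: "\<And>t. (F has_real_derivative f t) (at t)" and f: "continuous_on UNIV f"
    and R: "\<And>t. \<bar>t\<bar> \<ge> R \<Longrightarrow> F t = 0"
  shows "(LINT t|lborel. f t) = 0"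
proof -
  define S where "S = \<bar>R\<bar> + 1"
  have F0: "F t = 0" if "t \<notin> {- S..S}" for t
    using that by (intro R) (auto simp: S_def)
  have "f t = 0" if "t \<notin> {- S..S}" for t
  proof -
    have "(F has_real_derivative 0) (at t)"
      by (rule has_field_derivative_transform_within_open[of "\<lambda>_. 0" _ _ "- {- S..S}"])
        (use that F0 in auto)
    with F[of t] show ?thesis by (rule DERIV_unique)
  qed
  then have "f = (\<lambda>t. f t * indicator {- S..S} t)" by (intro ext) (auto simp: indicator_def)
  moreover have "(LINT t|lborel. f t * indicator {- S..S} t) = F S - F (- S)"
    using f by (intro integral_FTC_Icc_real F) (auto simp: S_def continuous_on_eq_continuous_at)
  ultimately show ?thesis using R[of S] R[of "- S"] by (simp add: S_def)
qed

lemma grad_test_function: "test_function \<psi> \<Longrightarrow> test_function (\<lambda>x. grad \<psi> x $ k)"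
  by (simp add: grad_def test_function_derivative)

lemma grad_along_line:
  assumes "test_function \<psi>" "(g has_vector_derivative axis k 1) (at t)"
  shows "((\<lambda>t. \<psi> (g t)) has_real_derivative grad \<psi> (g t) $ k) (at t)"
  using has_derivative_compose[OF assms(2)[unfolded has_vector_derivative_def] test_function_differentiable[OF assms(1)]]
    linear_scale[OF has_derivative_linear[OF test_function_differentiable[OF assms(1)]]]
  by (simp add: has_field_derivative_def grad_def mult.commute[of _ "frechet_derivative _ _ _"])

lemma line_derivative:
  shows "((\<lambda>t. vector [t, y, z] :: real^3) has_vector_derivative axis 1 1) (at t)"
    and "((\<lambda>t. vector [x, t, z] :: real^3) has_vector_derivative axis 2 1) (at t)"
    and "((\<lambda>t. vector [x, y, t] :: real^3) has_vector_derivative axis 3 1) (at t)"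
  by (auto simp: vector3_eq intro!: derivative_eq_intros)

lemma continuous_on_vector3 [continuous_intros]:
  assumes "continuous_on S f" "continuous_on S g" "continuous_on S h"
  shows "continuous_on S (\<lambda>t. vector [f t, g t, h t] :: real^3)"
  unfolding vector3_eq by (intro continuous_intros assms)

lemma test_function_continuous_compose:
  assumes "test_function \<psi>" "continuous_on S g"
  shows "continuous_on S (\<lambda>t. \<psi> (g t))"
  using continuous_on_compose2[OF test_function_continuous[OF assms(1), of UNIV] assms(2)] by simp

text \<open>Integration by parts on a line parallel to a coordinate axis, with \<open>u\<close>
  playing the restriction of a potential to that line. The condition \<open>g t $ k = t\<close>
  drives the line out of the support of \<psi>, so no boundary terms remain.\<close>

lemma integral_grad_slice:
  fixes u :: "real \<Rightarrow> real" and g :: "real \<Rightarrow> real^3"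
  assumes \<psi>: "test_function \<psi>" and g: "\<And>t. (g has_vector_derivative axis k 1) (at t)" "\<And>t. g t $ k = t"
    and u: "\<And>t. (u has_real_derivative u' t) (at t)" and u': "continuous_on UNIV u'"
  shows "(LINT t|lborel. grad \<psi> (g t) $ k * u t + \<psi> (g t) * u' t) = 0"
proof -
  obtain R where R: "\<And>x. \<psi> x \<noteq> 0 \<Longrightarrow> norm x < R" using test_function_bound[OF \<psi>] by blast
  have g_cont: "continuous_on UNIV g"
    using g(1) by (meson continuous_at_imp_continuous_on has_vector_derivative_continuous)
  show ?thesis
  proof (rule integral_derivative_compact_support)
    show "((\<lambda>t. \<psi> (g t) * u t) has_real_derivative grad \<psi> (g t) $ k * u t + \<psi> (g t) * u' t) (at t)" for t
      by (auto intro!: derivative_eq_intros grad_along_line[OF \<psi> g(1)] u)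
    show "continuous_on UNIV (\<lambda>t. grad \<psi> (g t) $ k * u t + \<psi> (g t) * u' t)"
      using u by (intro continuous_intros u' test_function_continuous_compose[OF grad_test_function[OF \<psi>] g_cont]
        test_function_continuous_compose[OF \<psi> g_cont])
        (meson continuous_at_imp_continuous_on DERIV_isCont)
    show "\<psi> (g t) * u t = 0" if "\<bar>t\<bar> \<ge> R" for t
      using R[of "g t"] component_le_norm_cart[of "g t" k] g(2)[of t] that by force
  qed
qed

lemma test_function_bounded:
  assumes "test_function \<psi>"
  obtains C where "\<And>x. \<bar>\<psi> x\<bar> \<le> C"
proof -
  have "compact (closure {x. \<psi> x \<noteq> 0})" using assms by (simp add: test_function_def)
  then have "bounded (\<psi> ` closure {x. \<psi> x \<noteq> 0})"
    using test_function_continuous[OF assms] compact_continuous_image compact_imp_bounded by blast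
  then obtain C where C: "C > 0" "\<And>x. x \<in> closure {x. \<psi> x \<noteq> 0} \<Longrightarrow> \<bar>\<psi> x\<bar> \<le> C"
    unfolding bounded_pos by force
  have "\<bar>\<psi> x\<bar> \<le> C" for x
    using C closure_subset[of "{x. \<psi> x \<noteq> 0}"] by (cases "\<psi> x = 0") auto
  then show ?thesis by (rule that)
qed

text \<open>The constant \<open>D\<close> depends on the ball because the logarithm is unbounded at
  infinity. The two exempted planes are null sets and contain the singular line x = a, y =
  0.\<close>

definition locally_weighted :: "real \<Rightarrow> (real^3 \<Rightarrow> real) \<Rightarrow> bool" where
  "locally_weighted a u \<longleftrightarrow> u \<in> borel_measurable borel \<and> (\<forall>R. \<exists>D. \<forall>x. norm x < R \<longrightarrow> x $ 1 \<noteq> a \<longrightarrow> x $ 2 \<noteq> 0 \<longrightarrow>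
     \<bar>u x\<bar> \<le> D * (weight (x $ 1 - a) * weight (x $ 2)))"

lemma locally_weighted_integrable:
  assumes "locally_weighted a u" "\<psi> \<in> borel_measurable borel"
    and "\<And>x. \<bar>\<psi> x\<bar> \<le> C" "\<And>x. \<psi> x \<noteq> 0 \<Longrightarrow> norm x < R"
  shows "integrable lborel (\<lambda>x. \<psi> x * u x)"
proof -
  from assms(1) obtain D where "\<And>x. norm x < R \<Longrightarrow> x $ 1 \<noteq> a \<Longrightarrow> x $ 2 \<noteq> 0 \<Longrightarrow>
     \<bar>u x\<bar> \<le> D * (weight (x $ 1 - a) * weight (x $ 2))"
    unfolding locally_weighted_def by meson
  then show ?thesis
    using assms by (intro weighted_integrable[where C = C and D = D]) (auto simp: locally_weighted_def)
qed

lemma integrable_test_weighted: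
  assumes "test_function \<psi>" "locally_weighted a u"
  shows "integrable lborel (\<lambda>x. \<psi> x * u x)"
proof -
  obtain C where "\<And>x. \<bar>\<psi> x\<bar> \<le> C" using test_function_bounded[OF assms(1)] by blast
  moreover obtain R where "\<And>x. \<psi> x \<noteq> 0 \<Longrightarrow> norm x < R" using test_function_bound[OF assms(1)] by blast
  ultimately show ?thesis
    using assms by (intro locally_weighted_integrable) (auto intro: test_function_borel)
qed

lemma locally_weighted_bounded:
  assumes "u \<in> borel_measurable borel" "\<And>x. \<bar>u x\<bar> \<le> C"
  shows "locally_weighted a u"
  unfolding locally_weighted_def
proof (intro conjI allI exI impI assms(1))
  fix x :: "real^3"
  have "0 \<le> C" using assms(2)[of x] by linarith
  moreover have "1 \<le> weight (x $ 1 - a) * weight (x $ 2)"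
    using mult_mono[OF weight_ge_1 weight_ge_1] order_trans[OF zero_le_one weight_ge_1] by simp
  ultimately have "C * 1 \<le> C * (weight (x $ 1 - a) * weight (x $ 2))" by (intro mult_left_mono)
  with assms(2)[of x] show "\<bar>u x\<bar> \<le> C * (weight (x $ 1 - a) * weight (x $ 2))" by simp
qed

section \<open>Logarithm, angle and their common derivative around an end of the array\<close>

definition log_pot :: "real \<Rightarrow> real^3 \<Rightarrow> real"
  where "log_pot a x = ln ((x $ 1 - a)\<^sup>2 + (x $ 2)\<^sup>2) / 2"

text \<open>Together with \<open>log_pot\<close> this is the complex logarithm of (x - a) + i y up
  to a branch. This branch jumps across the plane x = a and not along the array.\<close>

definition angle_pot :: "real \<Rightarrow> real^3 \<Rightarrow> real"
  where "angle_pot a x = arctan (x $ 2 / (x $ 1 - a))"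

text \<open>The common value of the x-derivative of \<open>log_pot\<close> and the y-derivative of
  \<open>angle_pot\<close>, that is, one of the Cauchy-Riemann equations.\<close>

definition line_kernel :: "real \<Rightarrow> real^3 \<Rightarrow> real"
  where "line_kernel a x = (x $ 1 - a) / ((x $ 1 - a)\<^sup>2 + (x $ 2)\<^sup>2)"

lemma pot_borel [measurable]:
  "log_pot a \<in> borel_measurable borel" "angle_pot a \<in> borel_measurable borel"
  "line_kernel a \<in> borel_measurable borel"
  unfolding log_pot_def[abs_def] angle_pot_def[abs_def] line_kernel_def[abs_def] by measurable

lemma locally_weighted_angle_pot: "locally_weighted a (angle_pot a)"
proof (rule locally_weighted_bounded[OF pot_borel(2)])
  show "\<bar>angle_pot a x\<bar> \<le> pi / 2" for x
    using arctan_bounded[of "x $ 2 / (x $ 1 - a)"] unfolding angle_pot_def by linarith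
qed

lemma locally_weighted_log_pot: "locally_weighted a (log_pot a)"
  unfolding locally_weighted_def
proof (intro conjI allI)
  fix R :: real
  define S where "S = (\<bar>R\<bar> + \<bar>a\<bar>)\<^sup>2 + R\<^sup>2"
  show "\<exists>D. \<forall>x. norm x < R \<longrightarrow> x $ 1 \<noteq> a \<longrightarrow> x $ 2 \<noteq> 0 \<longrightarrow>
     \<bar>log_pot a x\<bar> \<le> D * (weight (x $ 1 - a) * weight (x $ 2))"
  proof (intro exI allI impI)
    fix x :: "real^3"
    assume x: "norm x < R" "x $ 1 \<noteq> a" "x $ 2 \<noteq> 0"
    define t where "t = (x $ 1 - a)\<^sup>2 + (x $ 2)\<^sup>2"
    define p where "p = \<bar>x $ 2\<bar> powr (- 1 / 2)"
    have "t > 0" using x by (simp add: t_def add_nonneg_pos)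
    have "p > 0" using x by (simp add: p_def)
    have "S \<ge> 0" by (simp add: S_def)
    have ub: "ln t \<le> S"
    proof -
      have "\<bar>x $ 1 - a\<bar> \<le> \<bar>R\<bar> + \<bar>a\<bar>" "\<bar>x $ 2\<bar> \<le> \<bar>R\<bar>"
        using component_le_norm_cart[of x 1] component_le_norm_cart[of x 2] x(1) by linarith+
      then have "t \<le> S" unfolding t_def S_def
        by (intro add_mono; subst abs_le_square_iff[symmetric]) auto
      with ln_le_minus_one[OF \<open>t > 0\<close>] show ?thesis by linarith
    qed
    \<comment> \<open>With p = \<bar>y\<bar>^(-1/2) one has -ln (y^2) = 4 ln p, and ln p \<le> p - 1
      turns the logarithm into the power that \<open>weight\<close> contains.\<close>
    have lb: "- ln t \<le> 4 * p"
    proof -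
      have "ln ((x $ 2)\<^sup>2) \<le> ln t" using x by (intro ln_mono) (auto simp: t_def)
      moreover have "ln ((x $ 2)\<^sup>2) = 2 * ln \<bar>x $ 2\<bar>"
        using ln_realpow[of "\<bar>x $ 2\<bar>" 2] x by simp
      moreover have "ln p = - ln \<bar>x $ 2\<bar> / 2" using x by (simp add: p_def ln_powr)
      ultimately show ?thesis using ln_le_minus_one[OF \<open>p > 0\<close>] by linarith
    qed
    have "\<bar>log_pot a x\<bar> \<le> S + 2 * p"
      using ub lb \<open>p > 0\<close> \<open>S \<ge> 0\<close> unfolding log_pot_def t_def[symmetric] by auto
    also have "\<dots> \<le> (S + 2) * weight (x $ 2)"
      using \<open>p > 0\<close> \<open>S \<ge> 0\<close> by (simp add: weight_def p_def algebra_simps)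
    also have "\<dots> \<le> (S + 2) * (weight (x $ 1 - a) * weight (x $ 2))"
      using weight_ge_1[of "x $ 1 - a"] weight_ge_1[of "x $ 2"] \<open>S \<ge> 0\<close>
      by (intro mult_left_mono) (auto simp: mult_le_cancel_right1)
    finally show "\<bar>log_pot a x\<bar> \<le> (S + 2) * (weight (x $ 1 - a) * weight (x $ 2))" .
  qed
qed simp

text \<open>With s = \<bar>x - a\<bar> and t = \<bar>y\<bar>, the estimate s t \<le> s^2 + t^2 gives
  s / (s^2 + t^2) \<le> 1 / sqrt (s t). The singularity is thus shared evenly between the two
  coordinates, each factor being integrable on the line.\<close>

lemma locally_weighted_line_kernel: "locally_weighted a (line_kernel a)"
  unfolding locally_weighted_def
proof (intro conjI allI exI impI)
  fix x :: "real^3"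
  assume x: "x $ 1 \<noteq> a" "x $ 2 \<noteq> 0"
  define s t where "s = \<bar>x $ 1 - a\<bar>" and "t = \<bar>x $ 2\<bar>"
  have st: "s > 0" "t > 0" using x by (auto simp: s_def t_def)
  have "s / (s\<^sup>2 + t\<^sup>2) \<le> 1 / (sqrt s * sqrt t)"
  proof -
    have "s * t \<le> s\<^sup>2 + t\<^sup>2"
      using sum_squares_bound[of s t] mult_pos_pos[OF st] by linarith
    then have "(s * sqrt (s * t))\<^sup>2 \<le> (s\<^sup>2 + t\<^sup>2)\<^sup>2"
    proof -
      have "(s * sqrt (s * t))\<^sup>2 = s\<^sup>2 * (s * t)" using st by (simp add: power_mult_distrib)
      also have "\<dots> \<le> (s\<^sup>2 + t\<^sup>2) * (s\<^sup>2 + t\<^sup>2)"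
        using \<open>s * t \<le> s\<^sup>2 + t\<^sup>2\<close> st by (intro mult_mono) auto
      finally show ?thesis by (simp add: power2_eq_square)
    qed
    then have "s * sqrt (s * t) \<le> s\<^sup>2 + t\<^sup>2"
      by (rule power2_le_imp_le) simp
    then have "s * (sqrt s * sqrt t) \<le> s\<^sup>2 + t\<^sup>2" by (simp add: real_sqrt_mult)
    moreover have "sqrt s * sqrt t > 0" "s\<^sup>2 + t\<^sup>2 > 0"
      using st by (simp_all add: add_pos_pos)
    ultimately show ?thesis by (simp only: pos_divide_le_eq pos_le_divide_eq times_divide_eq_left mult_1)
  qed
  also have "\<dots> = s powr (- 1 / 2) * t powr (- 1 / 2)"
    using powr_minus_divide[of s "1 / 2"] powr_minus_divide[of t "1 / 2"] st by (simp add: powr_half_sqrt)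
  also have "\<dots> \<le> weight (x $ 1 - a) * weight (x $ 2)"
    unfolding weight_def s_def t_def by (intro mult_mono) auto
  finally show "\<bar>line_kernel a x\<bar> \<le> 1 * (weight (x $ 1 - a) * weight (x $ 2))"
    by (simp add: line_kernel_def s_def t_def abs_divide)
qed simp

lemma AE_pair_fst_neq: "AE p in lborel. fst (p :: real \<times> real) \<noteq> c"
proof -
  have "AE x in lborel. AE y in lborel. fst (x :: real, y :: real) \<noteq> c"
    using AE_lborel_singleton[of c] by (rule eventually_mono) auto
  then show ?thesis
    unfolding lborel_prod[symmetric] by (intro lborel_pair.AE_pair_measure) measurable
qed

text \<open>Both integrals equal \<open>-\<integral> \<psi> (line_kernel a)\<close>.\<close>

lemma curl_log_angle:
  assumes \<psi>: "test_function \<psi>"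
  shows "(LINT x|lborel. grad \<psi> x $ 1 * log_pot a x) = (LINT x|lborel. grad \<psi> x $ 2 * angle_pot a x)"
proof -
  note int = integrable_test_weighted[OF grad_test_function[OF \<psi>] locally_weighted_log_pot]
    integrable_test_weighted[OF grad_test_function[OF \<psi>] locally_weighted_angle_pot]
    integrable_test_weighted[OF \<psi> locally_weighted_line_kernel]
  have "(LINT x|lborel. grad \<psi> x $ 1 * log_pot a x + \<psi> x * line_kernel a x) = 0"
  proof -
    \<comment> \<open>Only the slices in the plane y = 0 can meet the singular line; on all others
      the logarithm is smooth.\<close>
    have "AE p in lborel. (case p of (y, z) \<Rightarrow> LINT t|lborel. grad \<psi> (vector [t, y, z]) $ 1 * log_pot a (vector [t, y, z])
       + \<psi> (vector [t, y, z]) * line_kernel a (vector [t, y, z])) = (0 :: real)"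
      using AE_pair_fst_neq[of 0]
    proof (rule eventually_mono)
      fix p :: "real \<times> real"
      obtain y z where p: "p = (y, z)" by fastforce
      assume "fst p \<noteq> 0"
      then have y: "y \<noteq> 0" by (simp add: p)
      have pos: "(t - a)\<^sup>2 + y\<^sup>2 > 0" for t using y by (simp add: add_nonneg_pos)
      have "(LINT t|lborel. grad \<psi> (vector [t, y, z]) $ 1 * (ln ((t - a)\<^sup>2 + y\<^sup>2) / 2)
         + \<psi> (vector [t, y, z]) * ((t - a) / ((t - a)\<^sup>2 + y\<^sup>2))) = 0"
      proof (rule integral_grad_slice[OF \<psi> line_derivative(1)])
        show "((\<lambda>t. ln ((t - a)\<^sup>2 + y\<^sup>2) / 2) has_real_derivative (t - a) / ((t - a)\<^sup>2 + y\<^sup>2)) (at t)" for t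
        proof -
          have "((\<lambda>t. ln ((t - a)\<^sup>2 + y\<^sup>2)) has_real_derivative 2 * ((t - a) / ((t - a)\<^sup>2 + y\<^sup>2))) (at t)"
            using pos[of t] by (auto intro!: derivative_eq_intros)
          from DERIV_cdivide[OF this, of 2] show ?thesis
            by (rule DERIV_cong) (rule nonzero_mult_div_cancel_left, simp)
        qed
        show "continuous_on UNIV (\<lambda>t. (t - a) / ((t - a)\<^sup>2 + y\<^sup>2))"
          using pos by (intro continuous_intros) (auto simp: less_le)
      qed simp
      then show "(case p of (y, z) \<Rightarrow> LINT t|lborel. grad \<psi> (vector [t, y, z]) $ 1 * log_pot a (vector [t, y, z])
         + \<psi> (vector [t, y, z]) * line_kernel a (vector [t, y, z])) = 0"
        by (simp add: p log_pot_def line_kernel_def)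
    qed
    then show ?thesis
      using int by (subst integral_slice_1) (auto intro!: integral_eq_zero_AE)
  qed
  moreover have "(LINT x|lborel. grad \<psi> x $ 2 * angle_pot a x + \<psi> x * line_kernel a x) = 0"
  proof -
    \<comment> \<open>Differentiation is along lines of constant x, so the jump of
      \<open>angle_pot\<close> across x = a is never crossed and leaves no trace.\<close>
    have "AE p in lborel. (case p of (x, z) \<Rightarrow> LINT t|lborel. grad \<psi> (vector [x, t, z]) $ 2 * angle_pot a (vector [x, t, z])
       + \<psi> (vector [x, t, z]) * line_kernel a (vector [x, t, z])) = (0 :: real)"
      using AE_pair_fst_neq[of a]
    proof (rule eventually_mono)
      fix p :: "real \<times> real"
      obtain x z where p: "p = (x, z)" by fastforce
      assume "fst p \<noteq> a"
      then have x: "x - a \<noteq> 0" by (simp add: p)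
      have pos: "(x - a)\<^sup>2 + t\<^sup>2 > 0" for t using x by (simp add: add_pos_nonneg)
      have "(LINT t|lborel. grad \<psi> (vector [x, t, z]) $ 2 * arctan (t / (x - a))
         + \<psi> (vector [x, t, z]) * ((x - a) / ((x - a)\<^sup>2 + t\<^sup>2))) = 0"
      proof (rule integral_grad_slice[OF \<psi> line_derivative(2)])
        have eq: "inverse (1 + (t / (x - a))\<^sup>2) * (1 / (x - a)) = (x - a) / ((x - a)\<^sup>2 + t\<^sup>2)" for t
        proof -
          have "1 + (t / (x - a))\<^sup>2 = ((x - a)\<^sup>2 + t\<^sup>2) / (x - a)\<^sup>2"
            using x by (simp add: power_divide add_divide_distrib)
          then show ?thesis using x by (simp add: power2_eq_square)
        qed
        show "((\<lambda>t. arctan (t / (x - a))) has_real_derivative (x - a) / ((x - a)\<^sup>2 + t\<^sup>2)) (at t)" for t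
          unfolding eq[symmetric] using x by (auto intro!: derivative_eq_intros)
        show "continuous_on UNIV (\<lambda>t. (x - a) / ((x - a)\<^sup>2 + t\<^sup>2))"
          using pos by (intro continuous_intros) (auto simp: less_le)
      qed simp
      then show "(case p of (x, z) \<Rightarrow> LINT t|lborel. grad \<psi> (vector [x, t, z]) $ 2 * angle_pot a (vector [x, t, z])
         + \<psi> (vector [x, t, z]) * line_kernel a (vector [x, t, z])) = 0"
        by (simp add: p angle_pot_def line_kernel_def)
    qed
    then show ?thesis
      using int by (subst integral_slice_2) (auto intro!: integral_eq_zero_AE)
  qed
  ultimately show ?thesis using int by simp
qed

text \<open>The factor \<open>v\<close> is constant on lines parallel to the z-axis, so each such
  line contributes the integral of a derivative with compact support.\<close>

lemma integral_grad_3: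
  assumes \<psi>: "test_function \<psi>" and u: "locally_weighted a (\<lambda>x. v (x $ 1) (x $ 2))"
  shows "(LINT x|lborel. grad \<psi> x $ 3 * v (x $ 1) (x $ 2)) = 0"
proof -
  have "(LINT t|lborel. grad \<psi> (vector [x, y, t]) $ 3 * v x y) = 0" for x y
    using integral_grad_slice[OF \<psi> line_derivative(3)[of x y], of "\<lambda>_. v x y" "\<lambda>_. 0"] by simp
  then show ?thesis
    unfolding integral_slice_3[OF integrable_test_weighted[OF grad_test_function[OF \<psi>] u]]
    by (simp only: vector_3 case_prod_unfold) simp
qed

lemma integral_grad:
  assumes \<psi>: "test_function \<psi>"
  shows "has_bochner_integral lborel (\<lambda>x. grad \<psi> x $ k) 0"
proof -
  have int: "integrable lborel (\<lambda>x. grad \<psi> x $ k)" for k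
    using integrable_test_weighted[OF grad_test_function[OF \<psi>] locally_weighted_bounded[of "\<lambda>_. 1" 1 0]] by simp
  have "(LINT t|lborel. grad \<psi> (vector [t, y, z]) $ 1) = 0" for y z
    using integral_grad_slice[OF \<psi> line_derivative(1)[of y z], of "\<lambda>_. 1" "\<lambda>_. 0"] by simp
  moreover have "(LINT t|lborel. grad \<psi> (vector [x, t, z]) $ 2) = 0" for x z
    using integral_grad_slice[OF \<psi> line_derivative(2)[of x z], of "\<lambda>_. 1" "\<lambda>_. 0"] by simp
  moreover have "(LINT t|lborel. grad \<psi> (vector [x, y, t]) $ 3) = 0" for x y
    using integral_grad_slice[OF \<psi> line_derivative(3)[of x y], of "\<lambda>_. 1" "\<lambda>_. 0"] by simp
  ultimately have "\<forall>k. (LINT x|lborel. grad \<psi> x $ k) = 0"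
    unfolding forall_3 integral_slice_1[OF int[of 1]] integral_slice_2[OF int[of 2]] integral_slice_3[OF int[of 3]]
    by (simp add: case_prod_unfold)
  with int show ?thesis by (simp add: has_bochner_integral_iff)
qed

text \<open>This is the rule that the derivative of sgn y is 2 \<delta>(y). Each of the two
  half-lines contributes the value of -\<psi> at y = 0; this is the only source of torsion in the
  curl of the frame.\<close>

lemma integral_grad_sgn:
  fixes c :: "real \<Rightarrow> real"
  assumes \<psi>: "test_function \<psi>" and [measurable]: "c \<in> borel_measurable borel" and C: "\<And>t. \<bar>c t\<bar> \<le> C"
  shows "(LINT x|lborel. grad \<psi> x $ 2 * (c (x $ 1) * sgn (x $ 2))) =
    - 2 * (LINT (x, z)|lborel. c x * \<psi> (vector [x, 0, z]))"
proof -
  have slice: "(LINT t|lborel. grad \<psi> (vector [x, t, z]) $ 2 * (c x * sgn t)) = - 2 * (c x * \<psi> (vector [x, 0, z]))" for x z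
  proof -
    let ?f = "\<lambda>t. \<psi> (vector [x, t, z])" and ?f' = "\<lambda>t. grad \<psi> (vector [x, t, z]) $ 2"
    obtain R where R: "R > 0" "\<And>x. \<psi> x \<noteq> 0 \<Longrightarrow> norm x < R" using test_function_bound[OF \<psi>] by blast
    obtain R' where R': "R' > 0" "\<And>x. grad \<psi> x $ 2 \<noteq> 0 \<Longrightarrow> norm x < R'"
      using test_function_bound[OF grad_test_function[OF \<psi>]] by blast
    define S where "S = max R R'"
    have f0: "?f t = 0" and f'0: "?f' t = 0" if "\<bar>t\<bar> \<ge> S" for t
      using R(2)[of "vector [x, t, z]"] R'(2)[of "vector [x, t, z]"] component_le_norm_cart[of "vector [x, t, z] :: real^3" 2] that
      by (force simp: S_def)+
    have "S > 0" using R(1) by (simp add: S_def)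
    have cont: "isCont ?f' t" for t
      using test_function_continuous_compose[OF grad_test_function[OF \<psi>], of UNIV "\<lambda>t. vector [x, t, z]" 2]
      using continuous_on_vector3[of UNIV "\<lambda>_. x" "\<lambda>t. t" "\<lambda>_. z"]
      by (simp add: continuous_on_eq_continuous_at)
    have D: "(?f has_real_derivative ?f' t) (at t)" for t by (rule grad_along_line[OF \<psi> line_derivative(2)])
    have "has_bochner_integral lborel (\<lambda>t. ?f' t * indicator {0..S} t - ?f' t * indicator {- S..0} t)
       ((?f S - ?f 0) - (?f 0 - ?f (- S)))"
      using \<open>S > 0\<close> by (intro has_bochner_integral_diff has_bochner_integral_FTC_Icc_real D cont) auto
    then have "(LINT t|lborel. ?f' t * indicator {0..S} t - ?f' t * indicator {- S..0} t) = - 2 * ?f 0"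
      using f0[of S] f0[of "- S"] \<open>S > 0\<close> by (simp add: has_bochner_integral_iff)
    \<comment> \<open>Both closed intervals contain 0 and cancel there, in agreement with
      \<open>sgn 0 = 0\<close>.\<close>
    moreover have "(\<lambda>t. ?f' t * indicator {0..S} t - ?f' t * indicator {- S..0} t) = (\<lambda>t. ?f' t * sgn t)"
    proof
      fix t
      show "?f' t * indicator {0..S} t - ?f' t * indicator {- S..0} t = ?f' t * sgn t"
        using f'0[of t] \<open>S > 0\<close> by (cases "\<bar>t\<bar> \<ge> S") (auto simp: indicator_def sgn_if)
    qed
    ultimately have "(LINT t|lborel. ?f' t * sgn t) = - 2 * ?f 0" by simp
    moreover have "(LINT t|lborel. ?f' t * (c x * sgn t)) = c x * (LINT t|lborel. ?f' t * sgn t)"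
      by (simp flip: integral_mult_right_zero add: ac_simps)
    ultimately show ?thesis by simp
  qed
  have "\<bar>c t * sgn s\<bar> \<le> C" for t s
    using C[of t] by (auto simp: abs_mult sgn_if)
  then have "locally_weighted 0 (\<lambda>x. c (x $ 1) * sgn (x $ 2))"
    by (intro locally_weighted_bounded[where C = C]) auto
  note int = integrable_test_weighted[OF grad_test_function[OF \<psi>] this, of 2]
  show ?thesis
    unfolding integral_slice_2[OF int] by (simp add: slice case_prod_unfold)
qed

subsection \<open>The Biot--Savart integral of a segment\<close>

text \<open>Integration along a dislocation line reduces the kernel of three-space to that of the
  plane. An antiderivative is t / (s^2 sqrt (s^2 + t^2)), with limits 1/s^2 and -1/s^2 at the two
  ends.\<close>

lemma norm_line_integral:
  fixes s z :: real
  assumes s: "s > 0"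
  shows "has_bochner_integral lborel (\<lambda>\<zeta>. 1 / sqrt (s\<^sup>2 + (z - \<zeta>)\<^sup>2) ^ 3) (2 / s\<^sup>2)"
proof -
  define F where "F = (\<lambda>t. t / (s\<^sup>2 * sqrt (s\<^sup>2 + t\<^sup>2)))"
  have pos: "s\<^sup>2 + t\<^sup>2 > 0" for t using s by (simp add: add_pos_nonneg)
  have D: "(F has_real_derivative 1 / sqrt (s\<^sup>2 + t\<^sup>2) ^ 3) (at t)" for t
  proof -
    define q where "q = sqrt (s\<^sup>2 + t\<^sup>2)"
    have q: "q > 0" "q\<^sup>2 = s\<^sup>2 + t\<^sup>2" using pos[of t] by (simp_all add: q_def)
    have "((\<lambda>t. sqrt (s\<^sup>2 + t\<^sup>2)) has_real_derivative t / q) (at t)"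
      using pos[of t] q(1) unfolding q_def by (auto intro!: derivative_eq_intros simp: field_simps)
    from DERIV_divide[OF DERIV_ident DERIV_cmult[OF this, of "s\<^sup>2"]]
    have "(F has_real_derivative (1 * (s\<^sup>2 * q) - t * (s\<^sup>2 * (t / q))) / (s\<^sup>2 * q * (s\<^sup>2 * q))) (at t)"
      using s q(1) unfolding F_def q_def by simp
    moreover have "(1 * (s\<^sup>2 * q) - t * (s\<^sup>2 * (t / q))) / (s\<^sup>2 * q * (s\<^sup>2 * q)) = (q\<^sup>2 - t\<^sup>2) / (s\<^sup>2 * q ^ 3)"
      using s q(1) by (simp add: field_simps power2_eq_square power3_eq_cube)
    ultimately show ?thesis using s q by (simp add: q_def[symmetric])
  qed
  have lim: "(F \<longlongrightarrow> 1 / s\<^sup>2) at_top"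
  proof -
    have "((\<lambda>t. 1 / (s\<^sup>2 * sqrt ((s * inverse t)\<^sup>2 + 1))) \<longlongrightarrow> 1 / (s\<^sup>2 * sqrt ((s * 0)\<^sup>2 + 1))) at_top"
      using s by (intro tendsto_intros tendsto_inverse_0_at_top filterlim_ident) auto
    then have "((\<lambda>t. 1 / (s\<^sup>2 * sqrt ((s * inverse t)\<^sup>2 + 1))) \<longlongrightarrow> 1 / s\<^sup>2) at_top" by simp
    then show ?thesis
    proof (rule Lim_transform_eventually)
      show "\<forall>\<^sub>F t in at_top. 1 / (s\<^sup>2 * sqrt ((s * inverse t)\<^sup>2 + 1)) = F t"
        using eventually_gt_at_top[of 0]
      proof eventually_elim
        case (elim t)
        have "(s * inverse t)\<^sup>2 + 1 = (s\<^sup>2 + t\<^sup>2) / t\<^sup>2"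
          using elim by (simp add: power_mult_distrib field_simps)
        then show ?case using elim by (simp add: F_def real_sqrt_divide)
      qed
    qed
  qed
  have lim': "(F \<longlongrightarrow> - (1 / s\<^sup>2)) at_bot"
    unfolding filterlim_at_bot_mirror
    using tendsto_minus[OF lim] by (simp add: F_def)
  have "set_integrable lborel (einterval (- \<infinity>) \<infinity>) (\<lambda>t. 1 / sqrt (s\<^sup>2 + t\<^sup>2) ^ 3)"
    and "(LBINT t=-\<infinity>..\<infinity>. 1 / sqrt (s\<^sup>2 + t\<^sup>2) ^ 3) = 1 / s\<^sup>2 - (- (1 / s\<^sup>2))"
    using D lim lim' pos s
    by (intro interval_integral_FTC_nonneg[where F = F]; 
      force intro!: continuous_intros simp: ereal_tendsto_simps less_imp_neq[symmetric] real_sqrt_ge_zero)+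
  then have "has_bochner_integral lborel (\<lambda>t. 1 / sqrt (s\<^sup>2 + t\<^sup>2) ^ 3) (2 / s\<^sup>2)"
    by (simp add: has_bochner_integral_iff set_integrable_def interval_lebesgue_integral_def set_lebesgue_integral_def)
  from this[THEN lborel_has_bochner_integral_real_affine_iff[THEN iffD1, rotated], of "-1" z] show ?thesis
    by simp
qed

text \<open>The convention that \<open>heaviside 0\<close> is 1 includes the left end and excludes
  the right one.\<close>

lemma heaviside_interval: "a \<le> c \<Longrightarrow> heaviside (t - a) - heaviside (t - c) = indicator {a..<c} t"
  by (auto simp: heaviside_def indicator_def)

lemma measurable_delta_y_map [measurable]: "(\<lambda>(x, z). vector [x, 0, z] :: real^3) \<in> borel_measurable borel"
  unfolding vector3_eq by (simp add: borel_prod[symmetric])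

lemma sets_delta_y [simp, measurable_cong]: "sets delta_y = sets borel"
  by (simp add: delta_y_def)

lemma integral_delta_y:
  fixes f :: "real^3 \<Rightarrow> 'a::{banach, second_countable_topology}"
  assumes "f \<in> borel_measurable borel"
  shows "(LINT x|delta_y. f x) = (LINT (x, z)|lborel. f (vector [x, 0, z]))"
proof -
  have "(LINT x|delta_y. f x) = (LINT p|lborel. f ((\<lambda>(x, z). vector [x, 0, z]) p))"
    unfolding delta_y_def using assms by (subst integral_distr) simp_all
  then show ?thesis by (simp add: case_prod_unfold)
qed

text \<open>Integrating over each dislocation line first leaves a planar kernel with elementary
  antiderivatives along the array; \<open>y \<noteq> 0\<close> keeps the denominators positive. The
  factor 2 from the lines turns 1/(4 pi) into 1/(2 pi). The angle appears as arctan ((\<xi> - x) /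
  y), which, unlike arctan (y / (\<xi> - x)), is smooth in \<xi> over the whole array.\<close>

lemma biot_savart_segment:
  fixes a c B :: real
  assumes ac: "a \<le> c" and y: "x $ 2 \<noteq> 0"
  shows "biot_savart delta_y (\<lambda>x. (B * indicator {a..<c} (x $ 1)) *\<^sub>R axis 3 1) x =
    (B / (2 * pi)) *\<^sub>R vector [- (arctan ((c - x $ 1) / x $ 2) - arctan ((a - x $ 1) / x $ 2)),
       ln ((x $ 1 - a)\<^sup>2 + (x $ 2)\<^sup>2) / 2 - ln ((x $ 1 - c)\<^sup>2 + (x $ 2)\<^sup>2) / 2, 0]"
proof -
  define s where "s = (\<lambda>\<xi>. sqrt ((x $ 1 - \<xi>)\<^sup>2 + (x $ 2)\<^sup>2))"
  define w :: "real \<Rightarrow> real^3" where "w = (\<lambda>\<xi>. (B * indicator {a..<c} \<xi>) *\<^sub>R vector [- x $ 2, x $ 1 - \<xi>, 0])"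
  define f :: "real \<times> real \<Rightarrow> real^3" where "f = (\<lambda>(\<xi>, \<zeta>). (1 / sqrt ((s \<xi>)\<^sup>2 + (x $ 3 - \<zeta>)\<^sup>2) ^ 3) *\<^sub>R w \<xi>)"
  have r: "(x $ 1 - \<xi>)\<^sup>2 + (x $ 2)\<^sup>2 > 0" for \<xi> using y by (simp add: add_nonneg_pos)
  have s: "s \<xi> > 0" "(s \<xi>)\<^sup>2 = (x $ 1 - \<xi>)\<^sup>2 + (x $ 2)\<^sup>2" for \<xi> using r[of \<xi>] by (simp_all add: s_def)
  have [measurable]: "s \<in> borel_measurable borel" "w \<in> borel_measurable borel"
    unfolding s_def w_def vector3_eq by measurable
  have inner: "has_bochner_integral lborel (\<lambda>\<zeta>. f (\<xi>, \<zeta>)) ((2 / (s \<xi>)\<^sup>2) *\<^sub>R w \<xi>)" for \<xi>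
    unfolding f_def prod.case by (intro has_bochner_integral_scaleR_left norm_line_integral s)
  define g1 g2 where "g1 = (\<lambda>\<xi>. - arctan ((\<xi> - x $ 1) / x $ 2))" and "g2 = (\<lambda>\<xi>. - ln ((x $ 1 - \<xi>)\<^sup>2 + (x $ 2)\<^sup>2) / 2)"
  \<comment> \<open>\<open>h\<close> is the integrand without the cut-off. It is continuous, so the
    fundamental theorem applies on the closed interval; the half-open density differs from it there
    only at the single point \<open>c\<close>.\<close>
  define h where "h = (\<lambda>\<xi>. (2 * B / (s \<xi>)\<^sup>2) *\<^sub>R vector [- x $ 2, x $ 1 - \<xi>, 0] :: real^3)"
  define G where "G = (\<lambda>\<xi>. (2 * B) *\<^sub>R (g1 \<xi> *\<^sub>R axis 1 1 + g2 \<xi> *\<^sub>R axis 2 1) :: real^3)"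
  have h: "has_bochner_integral lborel (\<lambda>\<xi>. indicator {a..c} \<xi> *\<^sub>R h \<xi>) (G c - G a)"
  proof (rule has_bochner_integral_FTC_Icc[OF ac])
    fix \<xi>
    have d1: "(g1 has_real_derivative - x $ 2 / (s \<xi>)\<^sup>2) (at \<xi>)"
    proof -
      have "1 + ((\<xi> - x $ 1) / x $ 2)\<^sup>2 = (s \<xi>)\<^sup>2 / (x $ 2)\<^sup>2"
        using y by (simp add: s(2) power_divide add_divide_distrib power2_commute)
      then have "inverse (1 + ((\<xi> - x $ 1) / x $ 2)\<^sup>2) * (1 / x $ 2) = x $ 2 / (s \<xi>)\<^sup>2"
        using y by (simp add: power2_eq_square)
      moreover have "(g1 has_real_derivative - (inverse (1 + ((\<xi> - x $ 1) / x $ 2)\<^sup>2) * (1 / x $ 2))) (at \<xi>)"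
        unfolding g1_def using y by (auto intro!: derivative_eq_intros)
      ultimately show ?thesis by simp
    qed
    have d2: "(g2 has_real_derivative (x $ 1 - \<xi>) / (s \<xi>)\<^sup>2) (at \<xi>)"
    proof -
      have "((\<lambda>\<xi>. - ln ((x $ 1 - \<xi>)\<^sup>2 + (x $ 2)\<^sup>2)) has_real_derivative 2 * ((x $ 1 - \<xi>) / (s \<xi>)\<^sup>2)) (at \<xi>)"
        using r[of \<xi>] unfolding s(2) by (auto intro!: derivative_eq_intros simp: divide_inverse algebra_simps)
      from DERIV_cdivide[OF this, of 2] show ?thesis
        unfolding g2_def by (rule DERIV_cong) (rule nonzero_mult_div_cancel_left, simp)
    qed
    have "(G has_vector_derivative (2 * B) *\<^sub>R ((- x $ 2 / (s \<xi>)\<^sup>2) *\<^sub>R axis 1 1 + ((x $ 1 - \<xi>) / (s \<xi>)\<^sup>2) *\<^sub>R axis 2 1))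
        (at \<xi> within {a..c})"
      unfolding G_def
      by (auto intro!: derivative_eq_intros has_field_derivative_at_within[OF d1] has_field_derivative_at_within[OF d2])
    moreover have "(2 * B) *\<^sub>R ((- x $ 2 / (s \<xi>)\<^sup>2) *\<^sub>R axis 1 1 + ((x $ 1 - \<xi>) / (s \<xi>)\<^sup>2) *\<^sub>R axis 2 1) = h \<xi>"
      by (simp add: h_def vec_eq_iff forall_3 axis_def)
    ultimately show "(G has_vector_derivative h \<xi>) (at \<xi> within {a..c})" by simp
  next
    show "continuous_on {a..c} h"
      unfolding h_def s(2) vector3_eq using r by (intro continuous_intros) (auto simp: less_le)
  qed
  have outer: "has_bochner_integral lborel (\<lambda>\<xi>. (2 / (s \<xi>)\<^sup>2) *\<^sub>R w \<xi>) (G c - G a)"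
  proof (rule has_bochner_integral_cong_AE[THEN iffD1, OF _ _ _ h])
    show "AE \<xi> in lborel. indicator {a..c} \<xi> *\<^sub>R h \<xi> = (2 / (s \<xi>)\<^sup>2) *\<^sub>R w \<xi>"
      using AE_lborel_singleton[of c] by eventually_elim (auto simp: indicator_def h_def w_def)
    show "(\<lambda>\<xi>. indicator {a..c} \<xi> *\<^sub>R h \<xi>) \<in> borel_measurable lborel" using h by auto
  qed measurable
  \<comment> \<open>Integrability on the product follows from the iterated integrals because the
    scalar kernel is positive: the inner integral of the norm is the norm of the inner
    integral.\<close>
  have int: "integrable (lborel \<Otimes>\<^sub>M lborel) f"
  proof (rule lborel_pair.Fubini_integrable)
    show [measurable]: "f \<in> borel_measurable (lborel \<Otimes>\<^sub>M lborel)" unfolding f_def by measurable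
    have "(LINT \<zeta>|lborel. norm (f (\<xi>, \<zeta>))) = norm ((2 / (s \<xi>)\<^sup>2) *\<^sub>R w \<xi>)" for \<xi>
    proof -
      have "norm (f (\<xi>, \<zeta>)) = norm (w \<xi>) * (1 / sqrt ((s \<xi>)\<^sup>2 + (x $ 3 - \<zeta>)\<^sup>2) ^ 3)" for \<zeta>
        by (simp add: f_def)
      then have "(LINT \<zeta>|lborel. norm (f (\<xi>, \<zeta>))) = norm (w \<xi>) * (2 / (s \<xi>)\<^sup>2)"
        by (simp only: has_bochner_integral_integral_eq[OF has_bochner_integral_mult_right[OF norm_line_integral[OF s(1)]]])
      then show ?thesis by simp
    qed
    moreover have "integrable lborel (\<lambda>\<xi>. norm ((2 / (s \<xi>)\<^sup>2) *\<^sub>R w \<xi>))"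
      using outer by (intro integrable_norm) (simp add: has_bochner_integral_iff)
    ultimately show "integrable lborel (\<lambda>\<xi>. LINT \<zeta>|lborel. norm (f (\<xi>, \<zeta>)))"
      by (simp only:)
    show "AE \<xi> in lborel. integrable lborel (\<lambda>\<zeta>. f (\<xi>, \<zeta>))"
      using inner by (auto simp: has_bochner_integral_iff)
  qed
  have "(LINT \<xi>|delta_y. (1 / norm (x - \<xi>) ^ 3) *\<^sub>R (((B * indicator {a..<c} (\<xi> $ 1)) *\<^sub>R axis 3 1) \<times> (x - \<xi>)))
      = (LINT p|lborel. f p)"
  proof (subst integral_delta_y)
    show "(\<lambda>\<xi>. (1 / norm (x - \<xi>) ^ 3) *\<^sub>R (((B * indicator {a..<c} (\<xi> $ 1)) *\<^sub>R axis 3 1) \<times> (x - \<xi>))) \<in> borel_measurable borel"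
      unfolding cross3_def vector3_eq by measurable
    have "(1 / norm (x - vector [\<xi>, 0, \<zeta>]) ^ 3) *\<^sub>R (((B * indicator {a..<c} \<xi>) *\<^sub>R axis 3 1) \<times> (x - vector [\<xi>, 0, \<zeta>])) = f (\<xi>, \<zeta>)" for \<xi> \<zeta>
    proof -
      have "norm (x - vector [\<xi>, 0, \<zeta>]) = sqrt ((s \<xi>)\<^sup>2 + (x $ 3 - \<zeta>)\<^sup>2)"
        by (simp add: norm_vec_def L2_set_def sum_3 s(2))
      moreover have "axis 3 1 \<times> (x - vector [\<xi>, 0, \<zeta>]) = vector [- x $ 2, x $ 1 - \<xi>, 0]"
        by (simp add: cross3_def vec_eq_iff forall_3 axis_def)
      ultimately show ?thesis by (simp add: f_def w_def cross_mult_left)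
    qed
    then show "(LINT (\<xi>, \<zeta>)|lborel. (1 / norm (x - vector [\<xi>, 0, \<zeta>]) ^ 3) *\<^sub>R
        (((B * indicator {a..<c} ((vector [\<xi>, 0, \<zeta>] :: real^3) $ 1)) *\<^sub>R axis 3 1) \<times> (x - vector [\<xi>, 0, \<zeta>]))) = (LINT p|lborel. f p)"
      by (intro Bochner_Integration.integral_cong refl) (simp add: split_beta del: scaleR_scaleR)
  qed
  also have "\<dots> = (LINT \<xi>|lborel. LINT \<zeta>|lborel. f (\<xi>, \<zeta>))"
    using lborel_pair.integral_fst'[OF int] by (simp add: lborel_prod)
  also have "\<dots> = G c - G a"
    using has_bochner_integral_integral_eq[OF inner] has_bochner_integral_integral_eq[OF outer] by simp
  finally have "biot_savart delta_y (\<lambda>x. (B * indicator {a..<c} (x $ 1)) *\<^sub>R axis 3 1) x = (1 / (4 * pi)) *\<^sub>R (G c - G a)"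
    by (simp only: biot_savart_def)
  also have "\<dots> = (B / (2 * pi)) *\<^sub>R vector [- (arctan ((c - x $ 1) / x $ 2) - arctan ((a - x $ 1) / x $ 2)),
       ln ((x $ 1 - a)\<^sup>2 + (x $ 2)\<^sup>2) / 2 - ln ((x $ 1 - c)\<^sup>2 + (x $ 2)\<^sup>2) / 2, 0]"
    by (simp add: vec_eq_iff forall_3 G_def g1_def g2_def axis_def field_simps)
  finally show ?thesis .
qed

text \<open>Converts the angle of the Biot--Savart integral into \<open>angle_pot\<close>; the sign
  terms are what becomes the jump of the frame over the array.\<close>

lemma arctan_reciprocal:
  assumes "c \<noteq> 0" "y \<noteq> 0"
  shows "arctan (c / y) = sgn c * sgn y * pi / 2 - arctan (y / (c::real))"
proof -
  have "arctan (1 / (y / c)) = sgn (y / c) * pi / 2 - arctan (y / c)"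
    using assms by (intro Transcendental.arctan_inverse) auto
  moreover have "sgn (y / c) = sgn c * sgn y"
    using assms by (cases "c > 0"; cases "y > 0") (auto simp: sgn_if zero_less_divide_iff)
  ultimately show ?thesis by simp
qed

subsection \<open>The plastic frame of the array\<close>

text \<open>The potentials of the two ends are dominated by weights centred at different points, and
  such bounds do not add up to one of the same form. This weaker notion is closed under linear
  combinations.\<close>

definition locally_integrable :: "(real^3 \<Rightarrow> real) \<Rightarrow> bool" where
  "locally_integrable u \<longleftrightarrow> (\<forall>\<psi> C R. \<psi> \<in> borel_measurable borel \<longrightarrow> (\<forall>x. \<bar>\<psi> x\<bar> \<le> C) \<longrightarrow>
     (\<forall>x. \<psi> x \<noteq> 0 \<longrightarrow> norm x < R) \<longrightarrow> integrable lborel (\<lambda>x. \<psi> x * u x))"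

lemma locally_integrableD:
  assumes "locally_integrable u" "\<psi> \<in> borel_measurable borel"
    and "\<And>x. \<bar>\<psi> x\<bar> \<le> C" "\<And>x. \<psi> x \<noteq> 0 \<Longrightarrow> norm x < R"
  shows "integrable lborel (\<lambda>x. \<psi> x * u x)"
  by (rule assms(1)[unfolded locally_integrable_def, rule_format]) (rule assms | assumption)+

lemma locally_integrableI:
  assumes "\<And>\<psi> C R. \<psi> \<in> borel_measurable borel \<Longrightarrow> (\<And>x. \<bar>\<psi> x\<bar> \<le> C) \<Longrightarrow>
     (\<And>x. \<psi> x \<noteq> 0 \<Longrightarrow> norm x < R) \<Longrightarrow> integrable lborel (\<lambda>x. \<psi> x * u x)"
  shows "locally_integrable u"
  unfolding locally_integrable_def by (intro allI impI, rule assms) (assumption | erule allE impE)+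

lemma locally_weighted_imp_locally_integrable: "locally_weighted a u \<Longrightarrow> locally_integrable u"
  by (rule locally_integrableI) (rule locally_weighted_integrable)

lemma locally_integrable_bounded:
  "u \<in> borel_measurable borel \<Longrightarrow> (\<And>x. \<bar>u x\<bar> \<le> C) \<Longrightarrow> locally_integrable u"
  by (rule locally_weighted_imp_locally_integrable, rule locally_weighted_bounded)

lemma locally_integrable_add:
  assumes "locally_integrable u" "locally_integrable v"
  shows "locally_integrable (\<lambda>x. u x + v x)"
proof (rule locally_integrableI)
  fix \<psi> :: "real^3 \<Rightarrow> real" and C R
  assume \<psi>: "\<psi> \<in> borel_measurable borel" "\<And>x. \<bar>\<psi> x\<bar> \<le> C" "\<And>x. \<psi> x \<noteq> 0 \<Longrightarrow> norm x < R"
  have u: "integrable lborel (\<lambda>x. \<psi> x * u x)" by (rule locally_integrableD[OF assms(1) \<psi>])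
  have v: "integrable lborel (\<lambda>x. \<psi> x * v x)" by (rule locally_integrableD[OF assms(2) \<psi>])
  from Bochner_Integration.integrable_add[OF u v]
  show "integrable lborel (\<lambda>x. \<psi> x * (u x + v x))" by (simp only: distrib_left)
qed

lemma locally_integrable_cmult:
  assumes "locally_integrable u"
  shows "locally_integrable (\<lambda>x. k * u x)"
proof (rule locally_integrableI)
  fix \<psi> :: "real^3 \<Rightarrow> real" and C R
  assume \<psi>: "\<psi> \<in> borel_measurable borel" "\<And>x. \<bar>\<psi> x\<bar> \<le> C" "\<And>x. \<psi> x \<noteq> 0 \<Longrightarrow> norm x < R"
  have "integrable lborel (\<lambda>x. \<psi> x * u x)" by (rule locally_integrableD[OF assms \<psi>])
  from integrable_mult_right[OF this, of k]
  show "integrable lborel (\<lambda>x. \<psi> x * (k * u x))" by (simp only: mult.left_commute)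
qed

lemma locally_integrable_diff:
  assumes "locally_integrable u" "locally_integrable v"
  shows "locally_integrable (\<lambda>x. u x - v x)"
  using locally_integrable_add[OF assms(1) locally_integrable_cmult[OF assms(2), of "- 1"]] by simp

lemma integrable_indicator_locally:
  assumes "bounded K" "K \<in> sets borel" "locally_integrable u"
  shows "integrable lborel (\<lambda>x. indicator K x * u x)"
proof -
  obtain R where R: "\<And>x. x \<in> K \<Longrightarrow> norm x \<le> R" using assms(1) by (auto simp: bounded_iff)
  show ?thesis
  proof (rule locally_integrableD[OF assms(3)])
    show "\<bar>indicator K x :: real\<bar> \<le> 1" for x by (simp add: indicator_def)
    show "norm x < R + 1" if "indicator K x \<noteq> (0::real)" for x
      using R[of x] that by (simp add: indicator_def split: if_splits)
  qed (use assms(2) in simp)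
qed

lemma bounded_linear_cross_left: "bounded_linear (\<lambda>u::real^3. u \<times> v)"
  unfolding linear_conv_bounded_linear[symmetric]
  by (rule linearI) (simp_all add: cross_add_left cross_mult_left)

lemma has_bochner_integral_vector3:
  assumes "has_bochner_integral M f1 v1" "has_bochner_integral M f2 v2" "has_bochner_integral M f3 v3"
  shows "has_bochner_integral M (\<lambda>x. vector [f1 x, f2 x, f3 x] :: real^3) (vector [v1, v2, v3])"
  unfolding vector3_eq by (intro has_bochner_integral_add has_bochner_integral_scaleR_left assms)

lemma integral_scaleR_axis:
  fixes f :: "'a \<Rightarrow> real"
  shows "(LINT x|M. f x *\<^sub>R axis k 1 :: real^3) = (LINT x|M. f x) *\<^sub>R axis k 1"
  by (rule integral_bounded_linear'[OF bounded_linear_scaleR_left bounded_linear_vec_nth[of k]]) simp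

locale dislocation_array =
  fixes a c B :: real and \<tau> \<theta> :: "3 \<Rightarrow> real^3 \<Rightarrow> real^3"
  assumes ac: "a < c"
    and \<tau>_def: "\<tau> = (\<lambda>i x. if i = 2 then (B * indicator {a..<c} (x $ 1)) *\<^sub>R axis 3 1 else 0)"
    and \<theta>_def: "\<theta> = plastic_frame delta_y \<tau>"
begin

definition P :: "real^3 \<Rightarrow> real"
  where "P x = (B / (2 * pi)) * (angle_pot a x - angle_pot c x) - (B / 2) * (indicator {a..<c} (x $ 1) * sgn (x $ 2))"

definition Q :: "real^3 \<Rightarrow> real"
  where "Q x = (B / (2 * pi)) * (log_pot a x - log_pot c x)"

lemma frame_other: "i \<noteq> 2 \<Longrightarrow> \<theta> i = (\<lambda>x. axis i 1)"
  by (auto simp: \<theta>_def \<tau>_def plastic_frame_def biot_savart_def)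

lemma frame_2:
  assumes x: "x $ 1 \<noteq> a" "x $ 1 \<noteq> c" "x $ 2 \<noteq> 0"
  shows "\<theta> 2 x = vector [P x, 1 + Q x, 0]"
proof -
  let ?A = "arctan ((c - x $ 1) / x $ 2) - arctan ((a - x $ 1) / x $ 2)"
  have "arctan (x $ 2 / (e - x $ 1)) = - angle_pot e x" for e
    using arctan_minus[of "x $ 2 / (x $ 1 - e)"] by (simp add: angle_pot_def minus_divide_right)
  \<comment> \<open>Away from the end points both signs are 1 or -1: they agree outside the interval
    and differ by 2 inside.\<close>
  moreover have "sgn (c - x $ 1) - sgn (a - x $ 1) = 2 * indicator {a..<c} (x $ 1)"
    using x ac by (auto simp: sgn_if)
  ultimately have "?A = pi * (indicator {a..<c} (x $ 1) * sgn (x $ 2)) - (angle_pot a x - angle_pot c x)"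
    using arctan_reciprocal[of "c - x $ 1" "x $ 2"] arctan_reciprocal[of "a - x $ 1" "x $ 2"] x
    by (simp add: field_simps)
  then have "(B / (2 * pi)) * - ?A = P x"
    by (simp only: P_def) (simp add: field_simps)
  moreover have "(B / (2 * pi)) * (ln ((x $ 1 - a)\<^sup>2 + (x $ 2)\<^sup>2) / 2 - ln ((x $ 1 - c)\<^sup>2 + (x $ 2)\<^sup>2) / 2) = Q x"
    by (simp only: Q_def log_pot_def)
  ultimately have "biot_savart delta_y (\<tau> 2) x = vector [P x, Q x, 0]"
    using biot_savart_segment[of a c x B] ac x(3)
    by (simp only: \<tau>_def if_True simp_thms vec_eq_iff forall_3 vector_3 vector_scaleR_component real_scaleR_def)
  then show ?thesis
    by (simp add: \<theta>_def plastic_frame_def vec_eq_iff forall_3 axis_def)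
qed

lemma AE_frame_2: "AE x in lborel. \<theta> 2 x = vector [P x, 1 + Q x, 0]"
  using AE_lborel_nth_neq[of 1 a] AE_lborel_nth_neq[of 1 c] AE_lborel_nth_neq[of 2 0]
  by eventually_elim (rule frame_2)

lemma PQ_borel [measurable]: "P \<in> borel_measurable borel" "Q \<in> borel_measurable borel"
  unfolding P_def[abs_def] Q_def[abs_def] by measurable

lemma locally_integrable_P: "locally_integrable P"
proof -
  have "\<bar>indicator {a..<c} (x $ 1) * sgn (x $ 2)\<bar> \<le> 1" for x :: "real^3"
    by (simp add: indicator_def sgn_if)
  then show ?thesis
    unfolding P_def[abs_def]
    by (intro locally_integrable_diff locally_integrable_cmult locally_integrable_bounded[where C = 1]
      locally_weighted_imp_locally_integrable[OF locally_weighted_angle_pot]) auto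
qed

lemma locally_integrable_Q: "locally_integrable Q"
  unfolding Q_def[abs_def]
  by (intro locally_integrable_diff locally_integrable_cmult
    locally_weighted_imp_locally_integrable[OF locally_weighted_log_pot])

lemma locally_integrable_1Q: "locally_integrable (\<lambda>x. 1 + Q x)"
  by (intro locally_integrable_add locally_integrable_Q locally_integrable_bounded[where C = 1]) auto

text \<open>\<open>radon_form\<close> demands Borel measurability everywhere, whereas the closed
  formula for \<theta> is known only off some planes. The proof therefore goes back to the defining
  integral, pulled back to Lebesgue measure on the plane, and uses measurability of integrals that
  depend on a parameter.\<close>

lemma frame_borel [measurable]: "\<theta> i \<in> borel_measurable borel"
proof (cases "i = 2")
  case True
  let ?k = "\<lambda>x \<xi>. (1 / norm (x - \<xi>) ^ 3) *\<^sub>R (\<tau> 2 \<xi> \<times> (x - \<xi>))"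
  let ?d = "\<lambda>(\<xi>, \<zeta>). vector [\<xi>, 0, \<zeta>] :: real^3"
  have d: "(\<lambda>(x, p). (x, ?d p)) \<in> borel \<Otimes>\<^sub>M lborel \<rightarrow>\<^sub>M borel \<Otimes>\<^sub>M (borel :: (real^3) measure)"
    using measurable_delta_y_map by measurable
  have k: "(\<lambda>(x, \<xi>). ?k x \<xi>) \<in> borel_measurable (borel \<Otimes>\<^sub>M borel)"
    unfolding \<tau>_def cross3_def vector3_eq by measurable
  from measurable_compose[OF d k] have "(\<lambda>x. LINT p|lborel. ?k x (?d p)) \<in> borel_measurable borel"
    by (intro lborel.borel_measurable_lebesgue_integral) (simp add: case_prod_unfold)
  moreover have "(LINT p|lborel. ?k x (?d p)) = (LINT \<xi>|delta_y. ?k x \<xi>)" for x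
  proof -
    have "?k x \<in> borel_measurable borel"
      unfolding \<tau>_def cross3_def vector3_eq by measurable
    then show ?thesis by (simp add: integral_delta_y case_prod_unfold)
  qed
  ultimately show ?thesis
    by (simp add: True \<theta>_def plastic_frame_def[abs_def] biot_savart_def)
qed (simp add: frame_other)

lemma set_integrable_frame:
  assumes "bounded K" "K \<in> sets borel"
  shows "set_integrable lborel K (\<theta> i)"
proof (cases "i = 2")
  case True
  have "integrable lborel (\<lambda>x. vector [indicator K x * P x, indicator K x * (1 + Q x), 0] :: real^3)"
    using has_bochner_integral_vector3[OF
      has_bochner_integral_integrable[OF integrable_indicator_locally[OF assms locally_integrable_P]]
      has_bochner_integral_integrable[OF integrable_indicator_locally[OF assms locally_integrable_1Q]]
      has_bochner_integral_zero]
    by (rule integrable.intros)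
  moreover have "AE x in lborel. vector [indicator K x * P x, indicator K x * (1 + Q x), 0] = indicator K x *\<^sub>R \<theta> i x"
    using AE_frame_2 by eventually_elim (simp add: True vec_eq_iff forall_3)
  moreover have "(\<lambda>x. indicator K x *\<^sub>R \<theta> i x) \<in> borel_measurable lborel"
    using assms(2) by measurable
  ultimately show ?thesis
    unfolding set_integrable_def
    by (subst integrable_cong_AE[symmetric]) auto
next
  case False
  have "integrable lborel (\<lambda>x. indicator K x * 1 :: real)"
    by (intro integrable_indicator_locally assms locally_integrable_bounded[where C = 1]) auto
  then show ?thesis
    by (simp add: set_integrable_def frame_other[OF False] integrable_scaleR_left)
qed

lemma radon_form_frame: "radon_form lborel (\<theta> i)"
  unfolding radon_form_def
proof (intro conjI allI impI)
  fix K :: "(real^3) set" assume K: "compact K"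
  then show "emeasure lborel K < \<infinity>" by (rule emeasure_compact_finite)
  show "set_integrable lborel K (\<theta> i)"
    using K by (intro set_integrable_frame compact_imp_bounded borel_compact)
qed simp_all

lemma ext_d_frame:
  assumes \<psi>: "test_function \<psi>"
  shows "ext_d lborel (\<theta> i) \<psi> = gen delta_y (\<tau> i) \<psi>"
proof (cases "i = 2")
  case True
  let ?S = "LINT (x, z)|lborel. indicator {a..<c} x * \<psi> (vector [x, 0, z])"
  note test = grad_test_function[OF \<psi>]
  have g3Q: "has_bochner_integral lborel (\<lambda>x. grad \<psi> x $ 3 * (1 + Q x)) 0"
  proof -
    have "(LINT x|lborel. grad \<psi> x $ 3 * log_pot e x) = 0" for e
      using integral_grad_3[OF \<psi>, of e "\<lambda>x y. ln ((x - e)\<^sup>2 + y\<^sup>2) / 2"] locally_weighted_log_pot[of e]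
      by (simp add: log_pot_def[abs_def])
    then have "has_bochner_integral lborel (\<lambda>x. grad \<psi> x $ 3 * log_pot e x) 0" for e
      using integrable_test_weighted[OF test locally_weighted_log_pot] by (simp add: has_bochner_integral_iff)
    from has_bochner_integral_add[OF integral_grad[OF \<psi>, of 3] has_bochner_integral_mult_right[OF
      has_bochner_integral_diff[OF this[of a] this[of c]], of "B / (2 * pi)"]]
    show ?thesis by (simp add: Q_def algebra_simps diff_divide_distrib)
  qed
  have g3P: "has_bochner_integral lborel (\<lambda>x. grad \<psi> x $ 3 * P x) 0"
  proof -
    have "(LINT x|lborel. grad \<psi> x $ 3 * angle_pot e x) = 0" for e
      using integral_grad_3[OF \<psi>, of e "\<lambda>x y. arctan (y / (x - e))"] locally_weighted_angle_pot[of e]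
      by (simp add: angle_pot_def[abs_def])
    then have 1: "has_bochner_integral lborel (\<lambda>x. grad \<psi> x $ 3 * angle_pot e x) 0" for e
      using integrable_test_weighted[OF test locally_weighted_angle_pot] by (simp add: has_bochner_integral_iff)
    have lw: "locally_weighted 0 (\<lambda>x. indicator {a..<c} (x $ 1) * sgn (x $ 2))"
      by (rule locally_weighted_bounded[where C = 1]) (auto simp: indicator_def sgn_if)
    have 2: "has_bochner_integral lborel (\<lambda>x. grad \<psi> x $ 3 * (indicator {a..<c} (x $ 1) * sgn (x $ 2))) 0"
      using integral_grad_3[OF \<psi>, of 0 "\<lambda>x y. indicator {a..<c} x * sgn y", OF lw] integrable_test_weighted[OF test lw]
      by (simp add: has_bochner_integral_iff)
    from has_bochner_integral_diff[OF has_bochner_integral_mult_right[OF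
      has_bochner_integral_diff[OF 1[of a] 1[of c]], of "B / (2 * pi)"] has_bochner_integral_mult_right[OF 2, of "B / 2"]]
    show ?thesis by (simp add: P_def algebra_simps diff_divide_distrib)
  qed
  \<comment> \<open>For each end the logarithm and the angle cancel by
    \<open>curl_log_angle\<close>, and the jump contributes (B / 2) times -2. The sign in
    \<open>ext_d\<close> turns the result into the prescribed positive torsion.\<close>
  have g12: "has_bochner_integral lborel (\<lambda>x. grad \<psi> x $ 1 * (1 + Q x) - grad \<psi> x $ 2 * P x) (- B * ?S)"
  proof -
    have lw: "locally_weighted 0 (\<lambda>x. indicator {a..<c} (x $ 1) * sgn (x $ 2))"
      by (rule locally_weighted_bounded[where C = 1]) (auto simp: indicator_def sgn_if)
    have 1: "has_bochner_integral lborel (\<lambda>x. grad \<psi> x $ 1 * log_pot e x - grad \<psi> x $ 2 * angle_pot e x) 0" for e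
      using curl_log_angle[OF \<psi>, of e] integrable_test_weighted[OF test locally_weighted_log_pot[of e]]
        integrable_test_weighted[OF test locally_weighted_angle_pot[of e]]
      by (simp add: has_bochner_integral_iff)
    have 2: "has_bochner_integral lborel (\<lambda>x. grad \<psi> x $ 2 * (indicator {a..<c} (x $ 1) * sgn (x $ 2))) (- 2 * ?S)"
      using integral_grad_sgn[OF \<psi>, of "indicator {a..<c}" 1] integrable_test_weighted[OF test lw]
      by (simp add: has_bochner_integral_iff indicator_def)
    from has_bochner_integral_add[OF has_bochner_integral_add[OF integral_grad[OF \<psi>, of 1] has_bochner_integral_mult_right[OF
      has_bochner_integral_diff[OF 1[of a] 1[of c]], of "B / (2 * pi)"]] has_bochner_integral_mult_right[OF 2, of "B / 2"]]
    show ?thesis by (simp add: P_def Q_def algebra_simps diff_divide_distrib)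
  qed
  have "has_bochner_integral lborel (\<lambda>x. vector [- (grad \<psi> x $ 3 * (1 + Q x)), grad \<psi> x $ 3 * P x,
      grad \<psi> x $ 1 * (1 + Q x) - grad \<psi> x $ 2 * P x] :: real^3) (vector [- 0, 0, - B * ?S])"
    by (intro has_bochner_integral_vector3 has_bochner_integral_minus g3Q g3P g12)
  moreover have "AE x in lborel. grad \<psi> x \<times> \<theta> 2 x = vector [- (grad \<psi> x $ 3 * (1 + Q x)), grad \<psi> x $ 3 * P x,
      grad \<psi> x $ 1 * (1 + Q x) - grad \<psi> x $ 2 * P x]"
    using AE_frame_2 by eventually_elim (simp add: cross3_def vec_eq_iff forall_3)
  moreover have "(\<lambda>x. grad \<psi> x \<times> \<theta> 2 x) \<in> borel_measurable lborel"
  proof -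
    have [measurable]: "(\<lambda>x. grad \<psi> x $ k) \<in> borel_measurable borel" for k
      by (rule test_function_borel[OF test])
    show ?thesis unfolding cross3_def vector3_eq by measurable
  qed
  ultimately have "(LINT x|lborel. grad \<psi> x \<times> \<theta> 2 x) = vector [- 0, 0, - B * ?S]"
    by (subst integral_cong_AE) (auto simp: has_bochner_integral_iff)
  moreover have "gen delta_y (\<tau> 2) \<psi> = vector [0, 0, B * ?S]"
  proof -
    have [measurable]: "\<psi> \<in> borel_measurable borel" by (rule test_function_borel[OF \<psi>])
    have "gen delta_y (\<tau> 2) \<psi> = (LINT x|delta_y. \<psi> x * (B * indicator {a..<c} (x $ 1))) *\<^sub>R axis 3 1"
      by (simp add: gen_def \<tau>_def integral_scaleR_axis)
    also have "(LINT x|delta_y. \<psi> x * (B * indicator {a..<c} (x $ 1))) = B * ?S"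
      by (subst integral_delta_y) (simp_all add: case_prod_unfold ac_simps flip: integral_mult_right_zero)
    finally show ?thesis by (simp add: vector3_eq)
  qed
  ultimately show ?thesis
    by (simp add: True ext_d_def vec_eq_iff forall_3)
next
  case False
  have "has_bochner_integral lborel (\<lambda>x. vector [grad \<psi> x $ 1, grad \<psi> x $ 2, grad \<psi> x $ 3]) (vector [0, 0, 0] :: real^3)"
    by (intro has_bochner_integral_vector3 integral_grad \<psi>)
  moreover have "vector [grad \<psi> x $ 1, grad \<psi> x $ 2, grad \<psi> x $ 3] = grad \<psi> x" for x
    by (simp add: vec_eq_iff forall_3)
  moreover have "(vector [0, 0, 0] :: real^3) = 0" by (simp add: vec_eq_iff forall_3)
  ultimately have "has_bochner_integral lborel (grad \<psi>) 0" by simp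
  from has_bochner_integral_bounded_linear[OF bounded_linear_cross_left this, of "axis i 1"]
  have "(LINT x|lborel. grad \<psi> x \<times> axis i 1) = 0" by (simp add: has_bochner_integral_iff)
  then show ?thesis by (simp add: ext_d_def gen_def \<tau>_def frame_other[OF False] False)
qed

lemma weitzenboeck_torsion: "has_torsion \<theta> lborel (\<lambda>i j x. 0) (\<lambda>i. gen delta_y (\<tau> i))"
proof -
  have zero: "radon_form lborel (\<lambda>x. 0)"
    unfolding radon_form_def
  proof (intro conjI allI impI)
    fix K :: "(real^3) set" assume "compact K"
    then show "emeasure lborel K < \<infinity>" by (rule emeasure_compact_finite)
    show "set_integrable lborel K (\<lambda>x. 0 :: real^3)" by (simp add: set_integrable_def)
  qed simp_all
  show ?thesis
    unfolding has_torsion_def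
  proof (intro conjI allI impI)
    fix i \<psi> assume "test_function \<psi>"
    then have "gen delta_y (\<tau> i) \<psi> - ext_d lborel (\<theta> i) \<psi> = 0" by (simp add: ext_d_frame)
    then show "has_bochner_integral lborel (\<lambda>x. \<psi> x *\<^sub>R (\<Sum>j\<in>UNIV. 0 \<times> precise (\<theta> j) x))
        (gen delta_y (\<tau> i) \<psi> - ext_d lborel (\<theta> i) \<psi>)"
      by (simp add: has_bochner_integral_zero)
  qed (rule radon_form_frame zero)+
qed

end

subsection \<open>Precise values\<close>

lemma measure_ball_pos: "r > 0 \<Longrightarrow> measure lborel (ball (x::real^3) r) > 0"
  by (rule content_ball_pos)

lemma ball_avg_const:
  assumes "r > 0"
  shows "ball_avg lborel (\<lambda>_. v) r x = v"
proof -
  have "(LINT y:ball x r|lborel. v) = measure lborel (ball x r) *\<^sub>R v"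
    unfolding set_lebesgue_integral_def using emeasure_lborel_ball_finite[of x r]
    by (subst integral_scaleR_left) auto
  then show ?thesis
    using measure_ball_pos[OF assms, of x] by (simp add: ball_avg_def)
qed

lemma eventually_at_right_pos: "\<forall>\<^sub>F r in at_right 0. r > (0 :: real)"
  by (simp add: eventually_at_right_less)

lemma precise_eq:
  "((\<lambda>r. ball_avg lborel f r x) \<longlongrightarrow> v) (at_right 0) \<Longrightarrow> precise f x = v"
  unfolding precise_def by (rule tendsto_Lim) simp

lemma ball_avg_const_tendsto: "((\<lambda>r. ball_avg lborel (\<lambda>_. v) r x) \<longlongrightarrow> v) (at_right 0)"
  by (rule tendsto_eventually) (rule eventually_mono[OF eventually_at_right_pos ball_avg_const])

text \<open>At a point of continuity the ball averages are squeezed between values close to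
  \<open>g x\<close>; this is how a precise value is computed from a formula.\<close>

lemma ball_average_tendsto:
  fixes g :: "real^3 \<Rightarrow> real"
  assumes int: "\<And>r. set_integrable lborel (ball x r) g" and cont: "isCont g x"
  shows "((\<lambda>r. (1 / measure lborel (ball x r)) * (LINT y:ball x r|lborel. g y)) \<longlongrightarrow> g x) (at_right 0)"
proof (rule tendstoI)
  fix e :: real assume "e > 0"
  then obtain d where d: "d > 0" "\<And>y. dist y x < d \<Longrightarrow> dist (g y) (g x) < e / 2"
    using cont[unfolded continuous_at_eps_delta, rule_format, of "e / 2"] by auto
  have "\<forall>\<^sub>F r in at_right 0. 0 < r \<and> r < d"
    using d(1) eventually_at_right[of 0 "0 + d"] by (auto simp: eventually_at_right_field)
  then show "\<forall>\<^sub>F r in at_right 0. dist ((1 / measure lborel (ball x r)) * (LINT y:ball x r|lborel. g y)) (g x) < e"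
  proof eventually_elim
    case (elim r)
    let ?m = "measure lborel (ball x r)"
    have m: "?m > 0" using elim by (simp add: measure_ball_pos)
    have const: "(LINT y:ball x r|lborel. k) = ?m * k" "set_integrable lborel (ball x r) (\<lambda>_. k)" for k :: real
      using emeasure_lborel_ball_finite[of x r]
      by (simp_all add: set_lebesgue_integral_def set_integrable_def)
    have close: "\<bar>g y - g x\<bar> < e / 2" if "y \<in> ball x r" for y
      using d(2)[of y] that elim by (simp add: dist_commute[of x] dist_real_def)
    have b: "g x - e / 2 \<le> g y" "g y \<le> g x + e / 2" if "y \<in> ball x r" for y
      using close[OF that] by linarith+
    have "(LINT y:ball x r|lborel. g x - e / 2) \<le> (LINT y:ball x r|lborel. g y)"
      by (intro set_integral_mono const int b)
    moreover have "(LINT y:ball x r|lborel. g y) \<le> (LINT y:ball x r|lborel. g x + e / 2)"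
      by (intro set_integral_mono const int b)
    ultimately have "g x - e / 2 \<le> (1 / ?m) * (LINT y:ball x r|lborel. g y)"
      "(1 / ?m) * (LINT y:ball x r|lborel. g y) \<le> g x + e / 2"
      using m unfolding const by (simp_all add: pos_le_divide_eq pos_divide_le_eq mult.commute)
    then show ?case using \<open>e > 0\<close> by (simp add: dist_real_def abs_less_iff)
  qed
qed

lemma integral_odd:
  fixes f :: "real \<Rightarrow> real"
  assumes "\<And>t. f (- t) = - f t"
  shows "(LINT t|lborel. f t) = 0"
  using lborel_integral_real_affine[of "- 1" f 0] assms by simp

context dislocation_array
begin

lemma precise_other: "i \<noteq> 2 \<Longrightarrow> precise (\<theta> i) x = axis i 1"
  by (simp add: frame_other precise_eq[OF ball_avg_const_tendsto])

lemma ball_avg_frame_2: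
  "ball_avg lborel (\<theta> 2) r x = (1 / measure lborel (ball x r)) *\<^sub>R
     vector [LINT y:ball x r|lborel. P y, LINT y:ball x r|lborel. 1 + Q y, 0]"
proof -
  have int: "integrable lborel (\<lambda>y. indicator (ball x r) y * P y)"
    "integrable lborel (\<lambda>y. indicator (ball x r) y * (1 + Q y))"
    by (intro integrable_indicator_locally locally_integrable_P locally_integrable_1Q; simp)+
  have "(LINT y:ball x r|lborel. \<theta> 2 y) =
     (LINT y|lborel. vector [indicator (ball x r) y * P y, indicator (ball x r) y * (1 + Q y), 0])"
    unfolding set_lebesgue_integral_def
  proof (rule integral_cong_AE)
    have [measurable]: "ball x r \<in> sets borel" by simp
    show "AE y in lborel. indicator (ball x r) y *\<^sub>R \<theta> 2 y =
        vector [indicator (ball x r) y * P y, indicator (ball x r) y * (1 + Q y), 0]"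
      using AE_frame_2 by eventually_elim (simp add: vec_eq_iff forall_3)
    show "(\<lambda>y. vector [indicator (ball x r) y * P y, indicator (ball x r) y * (1 + Q y), 0] :: real^3)
        \<in> borel_measurable lborel"
      unfolding vector3_eq by measurable
    show "(\<lambda>y. indicator (ball x r) y *\<^sub>R \<theta> 2 y) \<in> borel_measurable lborel"
      by measurable
  qed
  also have "\<dots> = vector [LINT y:ball x r|lborel. P y, LINT y:ball x r|lborel. 1 + Q y, 0]"
    unfolding set_lebesgue_integral_def real_scaleR_def
    by (intro has_bochner_integral_integral_eq has_bochner_integral_vector3
        has_bochner_integral_integrable has_bochner_integral_zero int)
  finally show ?thesis by (simp add: ball_avg_def)
qed

text \<open>A ball centred on the plane y = 0 is invariant under y to -y, and \<open>P\<close> is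
  odd under it. The average is zero for each radius and not just in the limit, also at the ends of
  the array.\<close>

lemma integral_P_ball:
  assumes x: "x $ 2 = 0"
  shows "(LINT y:ball x r|lborel. P y) = 0"
proof -
  have int: "integrable lborel (\<lambda>y. indicator (ball x r) y * P y)"
    by (intro integrable_indicator_locally locally_integrable_P) simp_all
  have "(LINT t|lborel. indicator (ball x r) (vector [u, t, v]) * P (vector [u, t, v])) = 0" for u v
  proof (rule integral_odd)
    fix t
    have "dist x (vector [u, - t, v]) = dist x (vector [u, t, v])"
      using x by (simp add: dist_norm norm_vec_def L2_set_def sum_3)
    moreover have "P (vector [u, - t, v]) = - P (vector [u, t, v])"
      by (simp add: P_def angle_pot_def arctan_minus sgn_minus algebra_simps diff_divide_distrib)
    ultimately show "indicator (ball x r) (vector [u, - t, v]) * P (vector [u, - t, v]) =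
        - (indicator (ball x r) (vector [u, t, v]) * P (vector [u, t, v]))"
      by (simp add: indicator_def)
  qed
  then show ?thesis
    unfolding set_lebesgue_integral_def real_scaleR_def integral_slice_2[OF int]
    by (simp add: case_prod_unfold)
qed

lemma precise_2_nth_3:
  assumes "has_precise_value (\<theta> 2) x"
  shows "precise (\<theta> 2) x $ 3 = 0"
proof -
  obtain v where v: "((\<lambda>r. ball_avg lborel (\<theta> 2) r x) \<longlongrightarrow> v) (at_right 0)"
    using assms by (auto simp: has_precise_value_def)
  have "((\<lambda>r. 0) \<longlongrightarrow> v $ 3) (at_right (0::real))"
    using tendsto_vec_nth[OF v, of 3] by (simp add: ball_avg_frame_2)
  then show ?thesis
    using precise_eq[OF v] by (simp add: tendsto_const_iff)
qed

text \<open>The existence of the limit is assumed because \<open>precise\<close> is otherwise an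
  unspecified value of \<open>Lim\<close>; in the application it comes from
  \<open>coframe_at\<close>.\<close>

lemma precise_2_nth_1:
  assumes "has_precise_value (\<theta> 2) x" "x $ 2 = 0"
  shows "precise (\<theta> 2) x $ 1 = 0"
proof -
  obtain v where v: "((\<lambda>r. ball_avg lborel (\<theta> 2) r x) \<longlongrightarrow> v) (at_right 0)"
    using assms by (auto simp: has_precise_value_def)
  have "((\<lambda>r. 0) \<longlongrightarrow> v $ 1) (at_right (0::real))"
    using tendsto_vec_nth[OF v, of 1] by (simp add: ball_avg_frame_2 integral_P_ball assms(2))
  then show ?thesis
    using precise_eq[OF v] by (simp add: tendsto_const_iff)
qed

lemma isCont_Q:
  assumes "x $ 1 \<noteq> a" "x $ 1 \<noteq> c"
  shows "isCont Q x"
proof -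
  have "isCont (log_pot e) x" if "x $ 1 \<noteq> e" for e
  proof -
    have "(x $ 1 - e)\<^sup>2 + (x $ 2)\<^sup>2 \<noteq> 0"
      using that by (simp add: sum_power2_eq_zero_iff)
    then show ?thesis
      unfolding log_pot_def[abs_def] by (intro continuous_intros) auto
  qed
  with assms show ?thesis unfolding Q_def[abs_def] by (intro continuous_intros) auto
qed

lemma frame_2_tendsto:
  assumes x: "x $ 2 = 0" "x $ 1 \<noteq> a" "x $ 1 \<noteq> c"
  shows "((\<lambda>r. ball_avg lborel (\<theta> 2) r x) \<longlongrightarrow> vector [0, 1 + Q x, 0]) (at_right 0)"
proof (rule vec_tendstoI)
  have "((\<lambda>r. (1 / measure lborel (ball x r)) * (LINT y:ball x r|lborel. 1 + Q y)) \<longlongrightarrow> 1 + Q x) (at_right 0)"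
  proof (rule ball_average_tendsto)
    show "set_integrable lborel (ball x r) (\<lambda>y. 1 + Q y)" for r
      unfolding set_integrable_def real_scaleR_def
      by (intro integrable_indicator_locally locally_integrable_1Q) simp_all
    show "isCont (\<lambda>y. 1 + Q y) x" by (intro continuous_intros isCont_Q x)
  qed
  then show "((\<lambda>r. ball_avg lborel (\<theta> 2) r x $ i) \<longlongrightarrow> vector [0, 1 + Q x, 0] $ i) (at_right 0)" for i
    using exhaust_3[of i] by (auto simp: ball_avg_frame_2 integral_P_ball[OF x(1)])
qed

lemma coframe_at_segment:
  assumes x: "x $ 2 = 0" "x $ 1 \<noteq> a" "x $ 1 \<noteq> c" "1 + Q x \<noteq> 0"
  shows "coframe_at \<theta> x"
proof -
  have "has_precise_value (\<theta> i) x" for i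
    using frame_2_tendsto[OF x(1-3)] ball_avg_const_tendsto[of "axis i 1" x]
    by (cases "i = 2") (auto simp: has_precise_value_def frame_other)
  moreover have "det (\<chi> i. precise (\<theta> i) x) = 1 + Q x"
    by (simp add: det_3 precise_other precise_eq[OF frame_2_tendsto[OF x(1-3)]] axis_def)
  ultimately show ?thesis using x(4) by (simp add: coframe_at_def)
qed

end

subsection \<open>The Levi-Civita connection\<close>

text \<open>The embedding of the plane preserves norms, so the part of \<open>K\<close> on the plane
  lies in a disc.\<close>

lemma emeasure_delta_y_compact:
  assumes "compact K"
  shows "emeasure delta_y K < \<infinity>"
proof -
  obtain R where R: "\<And>x. x \<in> K \<Longrightarrow> norm x \<le> R"
    using compact_imp_bounded[OF assms] by (auto simp: bounded_iff)
  have "emeasure delta_y K = emeasure lborel {p \<in> space lborel. (case p of (x, z) \<Rightarrow> vector [x, 0, z]) \<in> K}"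
    unfolding delta_y_def using assms by (subst emeasure_distr) (auto simp: borel_compact vimage_def)
  also have "\<dots> \<le> emeasure lborel (cball 0 R :: (real \<times> real) set)"
  proof (intro emeasure_mono subsetI)
    fix p assume p: "p \<in> {p \<in> space lborel. (case p of (x, z) \<Rightarrow> vector [x, 0, z]) \<in> K}"
    obtain x z where xz: "p = (x, z)" by fastforce
    have "norm (vector [x, 0, z] :: real^3) = norm (x, z)"
      by (simp add: norm_vec_def L2_set_def sum_3 norm_Pair)
    moreover have "vector [x, 0, z] \<in> K" using p xz by simp
    ultimately show "p \<in> cball 0 R" using R[of "vector [x, 0, z]"] by (simp add: xz)
  qed simp
  also have "\<dots> < \<infinity>" by (rule emeasure_lborel_cball_finite)
  finally show ?thesis .
qed

lemma AE_delta_y_nth_2: "AE x in delta_y. x $ 2 = 0"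
  unfolding delta_y_def by (subst AE_distr_iff) (auto simp: case_prod_unfold[symmetric])

lemma AE_delta_y_nth_1: "AE x in delta_y. x $ 1 \<noteq> e"
proof -
  have "AE p in lborel. (\<lambda>(x, z). vector [x, 0, z] :: real^3) p $ 1 \<noteq> e"
    using AE_pair_fst_neq[of e] by (rule eventually_mono) auto
  then show ?thesis
    unfolding delta_y_def by (subst AE_distr_iff) auto
qed

lemma integrable_slice_plane:
  fixes k :: "real \<Rightarrow> real"
  assumes \<psi>: "test_function \<psi>" and [measurable]: "k \<in> borel_measurable borel" and k: "\<And>t. \<bar>k t\<bar> \<le> D"
  shows "integrable lborel (\<lambda>(x, z). k x * \<psi> (vector [x, 0, z]))"
proof -
  obtain C where C: "\<And>x. \<bar>\<psi> x\<bar> \<le> C" using test_function_bounded[OF \<psi>] by blast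
  obtain R where R: "\<And>x. \<psi> x \<noteq> 0 \<Longrightarrow> norm x < R" using test_function_bound[OF \<psi>] by blast
  let ?I = "indicator {- R..R} :: real \<Rightarrow> real"
  have bound: "integrable lborel (\<lambda>p. (D * C) * (case p of (x, z) \<Rightarrow> ?I x * ?I z))"
    by (intro integrable_mult_right integrable_times_pair integrable_indicator_Icc)
  have "AE p in lborel. norm (case p of (x, z) \<Rightarrow> k x * \<psi> (vector [x, 0, z])) \<le> norm ((D * C) * (case p of (x, z) \<Rightarrow> ?I x * ?I z))"
  proof (rule AE_I2)
    fix p :: "real \<times> real"
    obtain x z where p: "p = (x, z)" by fastforce
    show "norm (case p of (x, z) \<Rightarrow> k x * \<psi> (vector [x, 0, z])) \<le> norm ((D * C) * (case p of (x, z) \<Rightarrow> ?I x * ?I z))"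
    proof (cases "\<psi> (vector [x, 0, z]) = 0")
      case False
      have "\<bar>x\<bar> \<le> R" "\<bar>z\<bar> \<le> R"
        using R[OF False] component_le_norm_cart[of "vector [x, 0, z] :: real^3" 1]
          component_le_norm_cart[of "vector [x, 0, z] :: real^3" 3] by auto
      then have "?I x = 1" "?I z = 1" by (auto simp: indicator_def abs_le_iff)
      moreover have "\<bar>k x * \<psi> (vector [x, 0, z])\<bar> \<le> D * C"
        unfolding abs_mult using k C by (intro mult_mono) (auto intro: order_trans[OF abs_ge_zero k])
      ultimately show ?thesis by (simp add: p)
    qed (simp add: p)
  qed
  moreover have "(\<lambda>(x, z). k x * \<psi> (vector [x, 0, z])) \<in> borel_measurable lborel"
  proof -
    have [measurable]: "\<psi> \<in> borel_measurable borel" by (rule test_function_borel[OF \<psi>])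
    show ?thesis unfolding vector3_eq by (simp add: borel_prod[symmetric])
  qed
  ultimately show ?thesis by (intro Bochner_Integration.integrable_bound[OF bound])
qed

text \<open>Here \<open>p\<close> stands for the second frame form and \<open>g\<close> for the only
  component of the wedge product that may be nonzero. The condition \<open>g * p $ 1 = 0\<close>
  covers two cases at once: on the plane y = 0 the frame component vanishes, off it the torsion
  does. It is what removes the dx component of \<open>w 1 2\<close>, since the equations give
  \<open>w 1 2 $ 1 * p $ 2 = g * p $ 1\<close>.\<close>

lemma cartan_pointwise:
  fixes w :: "3 \<Rightarrow> 3 \<Rightarrow> real^3" and p :: "real^3"
  assumes anti: "\<And>i j. w i j = - w j i"
    and p: "p $ 3 = 0" "p $ 2 \<noteq> 0" "g * p $ 1 = 0"
    and F1: "w 1 1 \<times> axis 1 1 + w 1 2 \<times> p + w 1 3 \<times> axis 3 1 = 0"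
    and F2: "w 2 1 \<times> axis 1 1 + w 2 2 \<times> p + w 2 3 \<times> axis 3 1 = vector [0, 0, g]"
    and F3: "w 3 1 \<times> axis 1 1 + w 3 2 \<times> p + w 3 3 \<times> axis 3 1 = 0"
  shows "w 1 2 = g *\<^sub>R axis 2 1" and "w 1 3 = 0" and "w 2 3 = 0"
proof -
  have diag: "w i i = 0" for i
    using anti[of i i] by (simp add: eq_neg_iff_add_eq_0 flip: scaleR_2)
  have "w 2 1 = - w 1 2" "w 3 1 = - w 1 3" "w 3 2 = - w 2 3" by (rule anti)+
  note eqs = F1[unfolded diag] F2[unfolded diag this] F3[unfolded diag this]
  have e: "w 1 3 $ 2 = w 1 2 $ 3 * p $ 2" "w 1 3 $ 1 = w 1 2 $ 3 * p $ 1"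
      "w 1 2 $ 1 * p $ 2 = w 1 2 $ 2 * p $ 1"
      "w 2 3 $ 2 = 0" "w 2 3 $ 1 = - w 1 2 $ 3" "w 1 2 $ 2 = g"
      "w 2 3 $ 3 * p $ 2 = 0" "w 1 3 $ 3 + w 2 3 $ 3 * p $ 1 = 0"
      "w 1 3 $ 2 = w 2 3 $ 1 * p $ 2 - w 2 3 $ 2 * p $ 1"
    using eqs p(1) by (auto simp: cross3_def vec_eq_iff forall_3 axis_def)
  \<comment> \<open>The first and the third equation both determine \<open>w 1 3 $ 2\<close>, with
    opposite signs; antisymmetry of the connection is what links them.\<close>
  have "w 1 2 $ 3 * p $ 2 = - (w 1 2 $ 3 * p $ 2)" using e(1,4,5,9) by simp
  then have "w 1 2 $ 3 = 0" using p(2) by simp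
  with e p show "w 1 2 = g *\<^sub>R axis 2 1" "w 1 3 = 0" "w 2 3 = 0"
    by (auto simp: vec_eq_iff forall_3 axis_def)
qed

section \<open>Existence of a Levi-Civita connection carried by the array\<close>

context dislocation_array
begin

definition segment :: "(real^3) set"
  where "segment = {x. a < x $ 1 \<and> x $ 1 < c \<and> x $ 2 = 0}"

text \<open>The density is supported on the open segment, and not on all of \<open>a \<le> x < c\<close>: there the precise values
  of the frame are known at every point, so that the torsion integrand is measurable.  Elsewhere
  \<open>precise\<close> may be the junk value of \<open>Lim\<close>.\<close>

definition \<omega>\<^sub>0 :: "3 \<Rightarrow> 3 \<Rightarrow> real^3 \<Rightarrow> real^3"
  where "\<omega>\<^sub>0 i j x = (if i = 1 \<and> j = 2 then - (B * indicator segment x) *\<^sub>R axis 2 1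
    else if i = 2 \<and> j = 1 then (B * indicator segment x) *\<^sub>R axis 2 1 else 0)"

text \<open>The distribution B (H(x - a) - H(x - c)) \<delta>(y). It expresses torsion and
  connection alike without reference to the measure of a particular connection.\<close>

definition charge :: "(real^3 \<Rightarrow> real) \<Rightarrow> real"
  where "charge \<psi> = B * (LINT (x, z)|lborel. indicator {a..<c} x * \<psi> (vector [x, 0, z]))"

lemma integrable_charge:
  "test_function \<psi> \<Longrightarrow> integrable lborel (\<lambda>(x, z). indicator {a..<c} x * \<psi> (vector [x, 0, z]))"
  by (rule integrable_slice_plane[where D = 1]) (simp_all add: indicator_def)

lemma has_bochner_integral_charge:
  assumes \<psi>: "test_function \<psi>"
  shows "has_bochner_integral delta_y (\<lambda>x. \<psi> x * (B * indicator {a..<c} (x $ 1))) (charge \<psi>)"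
proof -
  have [measurable]: "\<psi> \<in> borel_measurable borel" by (rule test_function_borel[OF \<psi>])
  have "has_bochner_integral lborel (\<lambda>p. B * (case p of (x, z) \<Rightarrow> indicator {a..<c} x * \<psi> (vector [x, 0, z]))) (charge \<psi>)"
    unfolding charge_def by (intro has_bochner_integral_mult_right has_bochner_integral_integrable integrable_charge \<psi>)
  then have "has_bochner_integral lborel (\<lambda>p. (\<lambda>x. \<psi> x * (B * indicator {a..<c} (x $ 1))) ((\<lambda>(x, z). vector [x, 0, z]) p)) (charge \<psi>)"
    by (simp add: case_prod_unfold ac_simps)
  then show ?thesis
    unfolding delta_y_def by (intro has_bochner_integral_distr) auto
qed

lemma gen_torsion:
  assumes \<psi>: "test_function \<psi>"
  shows "gen delta_y (\<tau> i) \<psi> = (if i = 2 then charge \<psi> *\<^sub>R axis 3 1 else 0)"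
  using has_bochner_integral_integral_eq[OF has_bochner_integral_charge[OF \<psi>]]
  by (simp add: gen_def \<tau>_def integral_scaleR_axis)

lemma segment_borel [measurable]: "segment \<in> sets borel"
  unfolding segment_def by measurable

lemma radon_form_\<omega>\<^sub>0: "radon_form delta_y (\<omega>\<^sub>0 i j)"
  unfolding radon_form_def
proof (intro conjI allI impI)
  show borel: "\<omega>\<^sub>0 i j \<in> borel_measurable borel"
    unfolding \<omega>\<^sub>0_def[abs_def] by measurable
  fix K :: "(real^3) set" assume K: "compact K"
  then show "emeasure delta_y K < \<infinity>" by (rule emeasure_delta_y_compact)
  then show "set_integrable delta_y K (\<omega>\<^sub>0 i j)"
    unfolding set_integrable_def using K borel
    by (intro integrableI_bounded_set_indicator[where B = "\<bar>B\<bar>"])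
      (auto simp: \<omega>\<^sub>0_def indicator_def borel_compact)
qed simp

text \<open>On the segment the precise second form is parallel to dy, as is the connection form, so
  the first equation holds whatever \<open>Q\<close> is. In the second equation the form dy meets dx
  and yields the torsion.\<close>

lemma connection_wedge_frame:
  "(\<Sum>j\<in>UNIV. \<omega>\<^sub>0 i j x \<times> precise (\<theta> j) x) = (if i = 2 then - (B * indicator segment x) *\<^sub>R axis 3 1 else 0)"
proof (cases "x \<in> segment")
  case True
  then have "precise (\<theta> 2) x = vector [0, 1 + Q x, 0]"
    by (intro precise_eq frame_2_tendsto) (auto simp: segment_def)
  then show ?thesis
    using exhaust_3[of i] True
    by (auto simp: sum_3 \<omega>\<^sub>0_def precise_other cross3_def vec_eq_iff forall_3 axis_def)
next
  case False
  then have "\<omega>\<^sub>0 i j x = 0" for j by (simp add: \<omega>\<^sub>0_def)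
  with False show ?thesis by simp
qed

text \<open>Existence keeps the curvature claim, which is about all Levi-Civita connections, from
  being vacuous. The condition on the coframe holds because the frame degenerates on at most one
  line inside the array, and single lines carry no mass of \<open>delta_y\<close>.\<close>

lemma levi_civita_\<omega>\<^sub>0: "levi_civita \<theta> delta_y \<omega>\<^sub>0"
  unfolding levi_civita_def
proof (intro conjI)
  show "AE x in delta_y. \<forall>i j. \<omega>\<^sub>0 i j x = - \<omega>\<^sub>0 j i x"
    by (auto simp: \<omega>\<^sub>0_def)
  show "has_torsion \<theta> delta_y \<omega>\<^sub>0 (\<lambda>i \<psi>. 0)"
    unfolding has_torsion_def
  proof (intro conjI allI impI radon_form_frame radon_form_\<omega>\<^sub>0)
    fix i \<psi> assume \<psi>: "test_function \<psi>"
    have [measurable]: "\<psi> \<in> borel_measurable borel" by (rule test_function_borel[OF \<psi>])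
    have "has_bochner_integral delta_y (\<lambda>x. \<psi> x * (B * indicator segment x)) (charge \<psi>)"
    proof (rule has_bochner_integral_cong_AE[THEN iffD1, OF _ _ _ has_bochner_integral_charge[OF \<psi>]])
      show "AE x in delta_y. \<psi> x * (B * indicator {a..<c} (x $ 1)) = \<psi> x * (B * indicator segment x)"
        using AE_delta_y_nth_2 AE_delta_y_nth_1[of a]
        by eventually_elim (auto simp: indicator_def segment_def)
    qed measurable
    from has_bochner_integral_scaleR_left[OF has_bochner_integral_minus[OF this], of "axis 3 1"]
    show "has_bochner_integral delta_y (\<lambda>x. \<psi> x *\<^sub>R (\<Sum>j\<in>UNIV. \<omega>\<^sub>0 i j x \<times> precise (\<theta> j) x)) (0 - ext_d lborel (\<theta> i) \<psi>)"
      by (cases "i = 2") (simp_all add: connection_wedge_frame ext_d_frame[OF \<psi>] gen_torsion[OF \<psi>] has_bochner_integral_zero)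
  qed
  \<comment> \<open>On the segment 1 + Q = 0 means (x - a) / (c - x) = k, whose only solution is x =
    (a + k c) / (1 + k). For B = 0 the quotient is 0 by convention; there the connection vanishes,
    so the excluded line is harmless.\<close>
  define k where "k = exp (- (2 * pi / B))"
  show "AE x in delta_y. (\<exists>i j. \<omega>\<^sub>0 i j x \<noteq> 0) \<longrightarrow> coframe_at \<theta> x"
    using AE_delta_y_nth_1[of "(a + k * c) / (1 + k)"]
  proof eventually_elim
    case (elim x)
    show ?case
    proof
      assume "\<exists>i j. \<omega>\<^sub>0 i j x \<noteq> 0"
      then have "B \<noteq> 0" and x: "a < x $ 1" "x $ 1 < c" "x $ 2 = 0"
        by (auto simp: \<omega>\<^sub>0_def indicator_def segment_def split: if_splits)
      have "1 + Q x \<noteq> 0"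
      proof
        assume 0: "1 + Q x = 0"
        have "ln ((x $ 1 - e)\<^sup>2) / 2 = ln \<bar>x $ 1 - e\<bar>" if "x $ 1 \<noteq> e" for e
          using ln_realpow[of "\<bar>x $ 1 - e\<bar>" 2] that by simp
        then have "Q x = B / (2 * pi) * (ln (x $ 1 - a) - ln (c - x $ 1))"
          using x by (simp add: Q_def log_pot_def)
        with 0 \<open>B \<noteq> 0\<close> have "ln (x $ 1 - a) - ln (c - x $ 1) = - (2 * pi / B)"
          by (simp add: field_simps)
        then have "ln (x $ 1 - a) = ln (k * (c - x $ 1))"
          using x by (simp add: k_def ln_mult)
        then have "x $ 1 - a = k * (c - x $ 1)"
          using x by (subst (asm) ln_inj_iff) (auto simp: k_def)
        moreover have "1 + k > 0" by (simp add: k_def add_pos_pos)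
        ultimately have "x $ 1 = (a + k * c) / (1 + k)" by (simp add: field_simps)
        with elim show False by simp
      qed
      with x show "coframe_at \<theta> x" by (intro coframe_at_segment) auto
    qed
  qed
qed

section \<open>The charge of derivatives of a test function\<close>

lemma charge_grad_3:
  assumes \<psi>: "test_function \<psi>"
  shows "charge (\<lambda>x. grad \<psi> x $ 3) = 0"
proof -
  have "(LINT z|lborel. grad \<psi> (vector [x, 0, z]) $ 3) = 0" for x
    using integral_grad_slice[OF \<psi> line_derivative(3)[of x 0], of "\<lambda>_. 1" "\<lambda>_. 0"] by simp
  moreover have "(LINT (x, z)|lborel. indicator {a..<c} x * grad \<psi> (vector [x, 0, z]) $ 3) =
      (LINT x|lborel. LINT z|lborel. indicator {a..<c} x * grad \<psi> (vector [x, 0, z]) $ 3)"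
    using lborel_pair.integral_fst'[of "\<lambda>(x, z). indicator {a..<c} x * grad \<psi> (vector [x, 0, z]) $ 3"]
      integrable_charge[OF grad_test_function[OF \<psi>, of 3]] by (simp add: lborel_prod)
  ultimately show ?thesis by (simp add: charge_def)
qed

lemma integrable_test_line:
  assumes "test_function \<psi>"
  shows "integrable lborel (\<lambda>z. \<psi> (vector [x, y, z]))"
proof -
  obtain R where R: "\<And>x. \<psi> x \<noteq> 0 \<Longrightarrow> norm x < R" using test_function_bound[OF assms] by blast
  have cont: "continuous_on {- R..R} (\<lambda>z. \<psi> (vector [x, y, z]))"
    by (intro test_function_continuous_compose[OF assms] continuous_intros)
  have "\<psi> (vector [x, y, z]) = indicator {- R..R} z *\<^sub>R \<psi> (vector [x, y, z])" for z
    using R[of "vector [x, y, z]"] component_le_norm_cart[of "vector [x, y, z] :: real^3" 3]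
    by (cases "\<psi> (vector [x, y, z]) = 0") (auto simp: indicator_def)
  then have eq: "(\<lambda>z. \<psi> (vector [x, y, z])) = (\<lambda>z. indicator {- R..R} z *\<^sub>R \<psi> (vector [x, y, z]))" by blast
  show ?thesis
    by (subst eq) (rule borel_integrable_compact[OF compact_Icc cont])
qed

text \<open>The origin of the two Dirac masses: the fundamental theorem of calculus along the array
  leaves the values of \<psi> on the lines through its two ends.\<close>

lemma charge_grad_1:
  assumes \<psi>: "test_function \<psi>"
  shows "charge (\<lambda>x. grad \<psi> x $ 1) =
    B * (LINT z|lborel. \<psi> (vector [c, 0, z])) - B * (LINT z|lborel. \<psi> (vector [a, 0, z]))"
proof -
  have "(LINT x|lborel. indicator {a..<c} x * grad \<psi> (vector [x, 0, z]) $ 1) = \<psi> (vector [c, 0, z]) - \<psi> (vector [a, 0, z])" for z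
  proof -
    let ?f' = "\<lambda>x. grad \<psi> (vector [x, 0, z]) $ 1"
    have "continuous_on UNIV ?f'"
      by (intro test_function_continuous_compose[OF grad_test_function[OF \<psi>]] continuous_intros)
    then have hb: "has_bochner_integral lborel (\<lambda>x. ?f' x * indicator {a..c} x) (\<psi> (vector [c, 0, z]) - \<psi> (vector [a, 0, z]))"
      using ac by (intro has_bochner_integral_FTC_Icc_real[where F = "\<lambda>x. \<psi> (vector [x, 0, z])"]
          grad_along_line[OF \<psi> line_derivative(1)]) (auto simp: continuous_on_eq_continuous_at)
    have "AE x in lborel. indicator {a..<c} x * ?f' x = ?f' x * indicator {a..c} x"
      using AE_lborel_singleton[of c] by eventually_elim (auto simp: indicator_def)
    then have "(LINT x|lborel. indicator {a..<c} x * ?f' x) = (LINT x|lborel. ?f' x * indicator {a..c} x)"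
      using borel_measurable_continuous_onI[OF \<open>continuous_on UNIV ?f'\<close>]
      by (intro integral_cong_AE) auto
    then show ?thesis using hb by (simp add: has_bochner_integral_iff)
  qed
  moreover have "(LINT (x, z)|lborel. indicator {a..<c} x * grad \<psi> (vector [x, 0, z]) $ 1) =
      (LINT z|lborel. LINT x|lborel. indicator {a..<c} x * grad \<psi> (vector [x, 0, z]) $ 1)"
    using lborel_pair.integral_snd[of "\<lambda>x z. indicator {a..<c} x * grad \<psi> (vector [x, 0, z]) $ 1"]
      integrable_charge[OF grad_test_function[OF \<psi>, of 1]] by (simp add: lborel_prod)
  ultimately show ?thesis
    by (simp add: charge_def integrable_test_line[OF \<psi>] right_diff_distrib)
qed

end

section \<open>Uniqueness of the connection and its curvature\<close>

lemma ext_d_zero: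
  assumes "AE x in M. u x = 0"
  shows "ext_d M u \<psi> = 0"
  unfolding ext_d_def using assms by (subst integral_eq_zero_AE) auto

lemma ball_avg_zero:
  assumes "AE x in M. u x = 0"
  shows "ball_avg M u r x = 0"
  unfolding ball_avg_def set_lebesgue_integral_def using assms by (subst integral_eq_zero_AE) auto

context dislocation_array
begin

text \<open>The density \<open>g\<close> depends on the choice of \<open>M\<close>; the intrinsic
  content is that its integrals against test functions are those of \<open>- charge\<close>. Any two
  Levi-Civita connections thus agree as generalised forms.\<close>

lemma levi_civita_unique:
  assumes lc: "levi_civita \<theta> M \<omega>"
  obtains g where "AE x in M. \<omega> 1 2 x = g x *\<^sub>R axis 2 1"
    and "\<And>\<psi>. test_function \<psi> \<Longrightarrow> has_bochner_integral M (\<lambda>x. \<psi> x * g x) (- charge \<psi>)"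
    and "AE x in M. \<forall>i j. {i, j} \<noteq> {1, 2} \<longrightarrow> \<omega> i j x = 0"
proof -
  from lc have anti: "AE x in M. \<forall>i j. \<omega> i j x = - \<omega> j i x"
    and coframe: "AE x in M. (\<exists>i j. \<omega> i j x \<noteq> 0) \<longrightarrow> coframe_at \<theta> x"
    and torsion: "has_torsion \<theta> M \<omega> (\<lambda>i \<psi>. 0)"
    by (auto simp: levi_civita_def)
  from torsion have sets: "sets M = sets borel" by (auto simp: has_torsion_def radon_form_def)
  define F where "F = (\<lambda>i x. \<Sum>j\<in>UNIV. \<omega> i j x \<times> precise (\<theta> j) x)"
  have F: "has_bochner_integral M (\<lambda>x. \<psi> x * F i x $ k) ((if i = 2 then - charge \<psi> *\<^sub>R axis 3 1 else 0) $ k)"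
    if "test_function \<psi>" for \<psi> i k
  proof -
    from torsion that have "has_bochner_integral M (\<lambda>x. \<psi> x *\<^sub>R F i x) (0 - ext_d lborel (\<theta> i) \<psi>)"
      unfolding has_torsion_def F_def by blast
    from has_bochner_integral_bounded_linear[OF bounded_linear_vec_nth this, of k]
    show ?thesis by (cases "i = 2") (simp_all add: ext_d_frame[OF that] gen_torsion[OF that])
  qed
  \<comment> \<open>The z-component of the second equation is the only one that is not forced to
    vanish weakly.\<close>
  define g where "g = (\<lambda>x. F 2 x $ 3)"
  have g: "has_bochner_integral M (\<lambda>x. \<psi> x * g x) (- charge \<psi>)" if "test_function \<psi>" for \<psi>
    using F[OF that, of 2 3] by (simp add: g_def)
  have "AE x in M. F i x $ k = 0" if "i \<noteq> 2 \<or> k \<noteq> 3" for i k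
  proof (rule AE_zero_if_weakly_zero[OF sets])
    fix \<psi> assume "test_function \<psi>"
    moreover have "(if i = 2 then - charge \<psi> *\<^sub>R axis 3 1 else 0 :: real^3) $ k = 0"
      using that by (auto simp: axis_def)
    ultimately show "has_bochner_integral M (\<lambda>x. \<psi> x * F i x $ k) 0" using F[of \<psi> i k] by simp
  qed
  then have F0: "AE x in M. \<forall>i k. i \<noteq> 2 \<or> k \<noteq> 3 \<longrightarrow> F i x $ k = 0"
    by (simp add: AE_all_countable)
  \<comment> \<open>the torsion lives on the plane \<open>y = 0\<close>, where the test function \<open>y \<psi>\<close> vanishes\<close>
  have "AE x in M. x $ 2 * g x = 0"
  proof (rule AE_zero_if_weakly_zero[OF sets])
    fix \<psi> assume "test_function \<psi>"
    from g[OF test_function_mult[OF this smooth_coord[of 2]]]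
    show "has_bochner_integral M (\<lambda>x. \<psi> x * (x $ 2 * g x)) 0"
      by (simp add: charge_def ac_simps case_prod_unfold)
  qed
  with anti coframe F0 have all: "AE x in M. \<omega> 1 2 x = g x *\<^sub>R axis 2 1 \<and> (\<forall>i j. {i, j} \<noteq> {1, 2} \<longrightarrow> \<omega> i j x = 0)"
  proof eventually_elim
    case (elim x)
    show ?case
    proof (cases "\<exists>i j. \<omega> i j x \<noteq> 0")
      case True
      with elim(2) have cof: "coframe_at \<theta> x" by blast
      then have hpv: "has_precise_value (\<theta> 2) x" by (simp add: coframe_at_def)
      let ?p = "precise (\<theta> 2) x"
      have "det (\<chi> i. precise (\<theta> i) x) = ?p $ 2"
        by (simp add: det_3 precise_other axis_def)
      then have p: "?p $ 3 = 0" "?p $ 2 \<noteq> 0" "g x * ?p $ 1 = 0"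
        using cof precise_2_nth_3[OF hpv] precise_2_nth_1[OF hpv] elim(4) by (auto simp: coframe_at_def)
      have "F 1 x = 0" "F 2 x = vector [0, 0, g x]" "F 3 x = 0"
        using elim(3) by (auto simp: vec_eq_iff forall_3 g_def)
      then have eqs: "\<omega> 1 1 x \<times> axis 1 1 + \<omega> 1 2 x \<times> ?p + \<omega> 1 3 x \<times> axis 3 1 = 0"
        "\<omega> 2 1 x \<times> axis 1 1 + \<omega> 2 2 x \<times> ?p + \<omega> 2 3 x \<times> axis 3 1 = vector [0, 0, g x]"
        "\<omega> 3 1 x \<times> axis 1 1 + \<omega> 3 2 x \<times> ?p + \<omega> 3 3 x \<times> axis 3 1 = 0"
        by (simp_all add: F_def sum_3 precise_other)
      have "\<omega> 1 2 x = g x *\<^sub>R axis 2 1" "\<omega> 1 3 x = 0" "\<omega> 2 3 x = 0"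
        by (rule cartan_pointwise[of "\<lambda>i j. \<omega> i j x" ?p "g x", OF elim(1)[rule_format] p eqs])+
      moreover have "\<omega> i i x = 0" for i
        using elim(1)[rule_format, of i i] by (simp add: eq_neg_iff_add_eq_0 flip: scaleR_2)
      moreover have "\<omega> 3 1 x = 0" "\<omega> 3 2 x = 0"
        using elim(1)[rule_format, of 3 1] elim(1)[rule_format, of 3 2] calculation by simp_all
      ultimately show ?thesis by (auto simp: forall_3 doubleton_eq_iff)
    next
      case False
      \<comment> \<open>Where the frame degenerates the connection is zero by the definition of
        \<open>levi_civita\<close>; then \<open>g\<close> is zero as well and the formula
        persists.\<close>
      then have "F 2 x = 0" by (simp add: F_def)
      with False show ?thesis by (simp add: g_def)
    qed
  qed
  show ?thesis
    by (rule that[OF _ g]) (use all in \<open>auto elim: eventually_mono\<close>)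
qed

text \<open>The quadratic term vanishes for each regularisation radius, so the limit in
  \<open>has_curvature\<close> is that of a constant, and the curvature is the distributional curl
  of the connection.\<close>

lemma curvature_pair:
  assumes lc: "levi_civita \<theta> M \<omega>"
  shows "has_curvature M \<omega> (wedge_disclination_pair B (a, 0) (- B) (c, 0))"
proof -
  obtain g where g: "AE x in M. \<omega> 1 2 x = g x *\<^sub>R axis 2 1"
    and int: "\<And>\<psi>. test_function \<psi> \<Longrightarrow> has_bochner_integral M (\<lambda>x. \<psi> x * g x) (- charge \<psi>)"
    and zero: "AE x in M. \<forall>i j. {i, j} \<noteq> {1, 2} \<longrightarrow> \<omega> i j x = 0"
    using levi_civita_unique[OF lc] by blast
  from lc have anti: "AE x in M. \<forall>i j. \<omega> i j x = - \<omega> j i x"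
    and radon: "radon_form M (\<omega> i j)" for i j
    by (auto simp: levi_civita_def has_torsion_def)
  have [measurable_cong]: "sets M = sets borel" and [measurable]: "\<omega> i j \<in> borel_measurable borel" for i j
    using radon by (auto simp: radon_form_def)
  have zero': "AE x in M. \<omega> i j x = 0" if "{i, j} \<noteq> {1, 2}" for i j
    using zero that by (auto elim: eventually_mono)
  have avg_zero: "ball_avg M (\<omega> i j) r x = 0" if "{i, j} \<noteq> {1, 2}" for i j r x
    by (rule ball_avg_zero[OF zero'[OF that]])
  have avg_anti: "ball_avg M (\<omega> 2 1) r x = - ball_avg M (\<omega> 1 2) r x" for r x
  proof -
    have "(LINT y:ball x r|M. \<omega> 2 1 y) = (LINT y:ball x r|M. - \<omega> 1 2 y)"
      unfolding set_lebesgue_integral_def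
    proof (rule integral_cong_AE)
      show "AE y in M. indicator (ball x r) y *\<^sub>R \<omega> 2 1 y = indicator (ball x r) y *\<^sub>R - \<omega> 1 2 y"
        using anti by (rule eventually_mono) metis
      have [measurable]: "ball x r \<in> sets borel" by simp
      show "(\<lambda>y. indicator (ball x r) y *\<^sub>R \<omega> 2 1 y) \<in> borel_measurable M"
        "(\<lambda>y. indicator (ball x r) y *\<^sub>R - \<omega> 1 2 y) \<in> borel_measurable M" by measurable
    qed
    then show ?thesis by (simp add: ball_avg_def set_lebesgue_integral_def)
  qed
  \<comment> \<open>Off the diagonal each product contains a vanishing factor; on the diagonal there
    remains at most the product of a vector with its own negative.\<close>
  have quadratic: "(\<Sum>k\<in>UNIV. ball_avg M (\<omega> i k) r x \<times> ball_avg M (\<omega> k j) r x) = 0" for i j r x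
    using exhaust_3[of i] exhaust_3[of j]
    by (auto simp: sum_3 avg_zero doubleton_eq_iff avg_anti cross_minus_left cross_minus_right)
  have d12: "ext_d M (\<omega> 1 2) \<psi> = charge (\<lambda>x. grad \<psi> x $ 1) *\<^sub>R axis 3 1" if \<psi>: "test_function \<psi>" for \<psi>
  proof -
    have [measurable]: "(\<lambda>x. grad \<psi> x $ k) \<in> borel_measurable borel" for k
      by (rule test_function_borel[OF grad_test_function[OF \<psi>]])
    have "has_bochner_integral M (\<lambda>x. vector [- (grad \<psi> x $ 3 * g x), 0, grad \<psi> x $ 1 * g x] :: real^3)
        (vector [- (- charge (\<lambda>x. grad \<psi> x $ 3)), 0, - charge (\<lambda>x. grad \<psi> x $ 1)])"
      by (intro has_bochner_integral_vector3 has_bochner_integral_minus has_bochner_integral_zero int grad_test_function \<psi>)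
    moreover have "AE x in M. vector [- (grad \<psi> x $ 3 * g x), 0, grad \<psi> x $ 1 * g x] = grad \<psi> x \<times> \<omega> 1 2 x"
      using g by eventually_elim (simp add: cross3_def vec_eq_iff forall_3 axis_def)
    moreover have "(\<lambda>x. grad \<psi> x \<times> \<omega> 1 2 x) \<in> borel_measurable M"
      unfolding cross3_def vector3_eq by measurable
    ultimately have "(LINT x|M. grad \<psi> x \<times> \<omega> 1 2 x) = vector [- (- charge (\<lambda>x. grad \<psi> x $ 3)), 0, - charge (\<lambda>x. grad \<psi> x $ 1)]"
      by (subst integral_cong_AE[symmetric]) (auto simp: has_bochner_integral_iff)
    then show ?thesis
      by (simp add: ext_d_def charge_grad_3[OF \<psi>] vec_eq_iff forall_3 axis_def)
  qed
  have d21: "ext_d M (\<omega> 2 1) \<psi> = - ext_d M (\<omega> 1 2) \<psi>" if \<psi>: "test_function \<psi>" for \<psi>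
  proof -
    have [measurable]: "(\<lambda>x. grad \<psi> x $ k) \<in> borel_measurable borel" for k
      by (rule test_function_borel[OF grad_test_function[OF \<psi>]])
    have "(LINT x|M. grad \<psi> x \<times> \<omega> 2 1 x) = (LINT x|M. - (grad \<psi> x \<times> \<omega> 1 2 x))"
    proof (rule integral_cong_AE)
      show "AE x in M. grad \<psi> x \<times> \<omega> 2 1 x = - (grad \<psi> x \<times> \<omega> 1 2 x)"
        using anti by (rule eventually_mono) (metis cross_minus_right)
      show "(\<lambda>x. grad \<psi> x \<times> \<omega> 2 1 x) \<in> borel_measurable M" "(\<lambda>x. - (grad \<psi> x \<times> \<omega> 1 2 x)) \<in> borel_measurable M"
        unfolding cross3_def vector3_eq by measurable
    qed
    then show ?thesis by (simp add: ext_d_def)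
  qed
  have line: "gen (delta_line p) (\<lambda>_. k *\<^sub>R (dx 1 \<times> dx 2)) \<psi> =
      (k * (LINT z|lborel. \<psi> (vector [fst p, snd p, z]))) *\<^sub>R axis 3 1" if \<psi>: "test_function \<psi>" for p k \<psi>
  proof -
    have [measurable]: "\<psi> \<in> borel_measurable borel" by (rule test_function_borel[OF \<psi>])
    have "dx 1 \<times> dx 2 = (axis 3 1 :: real^3)" by (simp add: cross3_def vec_eq_iff forall_3 axis_def)
    then have "gen (delta_line p) (\<lambda>_. k *\<^sub>R (dx 1 \<times> dx 2)) \<psi> = (LINT x|delta_line p. (k * \<psi> x) *\<^sub>R axis 3 1)"
      by (simp add: gen_def mult.commute)
    also have "\<dots> = (LINT x|delta_line p. k * \<psi> x) *\<^sub>R axis 3 1" by (rule integral_scaleR_axis)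
    also have "(LINT x|delta_line p. k * \<psi> x) = k * (LINT z|lborel. \<psi> (vector [fst p, snd p, z]))"
      unfolding delta_line_def vector3_eq by (subst integral_distr) auto
    finally show ?thesis .
  qed
  \<comment> \<open>The curl of the (1,2) form is B times the mass at \<open>c\<close> minus B times
    the mass at \<open>a\<close>. As a wedge disclination carries -\<phi> in this entry, the Frank
    vector is B at \<open>a\<close> and -B at \<open>c\<close>.\<close>
  have "wedge_disclination_pair B (a, 0) (- B) (c, 0) i j \<psi> = ext_d M (\<omega> i j) \<psi>" if \<psi>: "test_function \<psi>" for i j \<psi>
  proof -
    consider "i = 1" "j = 2" | "i = 2" "j = 1" | "{i, j} \<noteq> {1, 2}" by (auto simp: doubleton_eq_iff)
    then show ?thesis
    proof cases
      case 1
      then show ?thesis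
        using line[OF \<psi>, of "(a, 0)" "- B"] line[OF \<psi>, of "(c, 0)" B]
        by (simp add: wedge_disclination_pair_def wedge_disclination_def d12[OF \<psi>] charge_grad_1[OF \<psi>] algebra_simps)
    next
      case 2
      then show ?thesis
        using line[OF \<psi>, of "(a, 0)" B] line[OF \<psi>, of "(c, 0)" "- B"]
        by (simp add: wedge_disclination_pair_def wedge_disclination_def d21[OF \<psi>] d12[OF \<psi>] charge_grad_1[OF \<psi>] algebra_simps)
    next
      case 3
      then show ?thesis
        by (auto simp: wedge_disclination_pair_def wedge_disclination_def ext_d_zero[OF zero'[OF 3]])
    qed
  qed
  then show ?thesis
    by (simp add: has_curvature_def radon quadratic gen_def)
qed

end

theorem theorem4p1:
  fixes b Lm Lp \<rho> :: real and N :: nat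
    and \<tau> \<theta> :: "3 \<Rightarrow> real^3 \<Rightarrow> real^3"
  assumes "Lm > 0" and "Lp > 0"
    and "\<rho> = real N / (Lm + Lp)"
    and "\<tau> = (\<lambda>i x. if i = 2
                then (b * \<rho> * (heaviside (x $ 1 + Lm) - heaviside (x $ 1 - Lp))) *\<^sub>R (dx 1 \<times> dx 2)
                else 0)"
    and "\<theta> = plastic_frame delta_y \<tau>"
  shows "has_torsion \<theta> lborel (\<lambda>i j x. 0) (\<lambda>i. gen delta_y (\<tau> i)) \<and>
    (\<exists>M \<omega>. levi_civita \<theta> M \<omega>) \<and>
    (\<forall>M \<omega>. levi_civita \<theta> M \<omega> \<longrightarrow>
      has_curvature M \<omega> (wedge_disclination_pair (b * \<rho>) (- Lm, 0) (- (b * \<rho>)) (Lp, 0)))"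
proof -
  have "dx 1 \<times> dx 2 = (axis 3 1 :: real^3)" by (simp add: cross3_def vec_eq_iff forall_3 axis_def)
  \<comment> \<open>The ends of the array are \<open>- Lm\<close> and \<open>Lp\<close>; positivity
    of both lengths puts them in the order that the locale requires.\<close>
  moreover have "heaviside (t + Lm) - heaviside (t - Lp) = indicator {- Lm..<Lp} t" for t
    using heaviside_interval[of "- Lm" Lp t] assms(1,2) by simp
  ultimately have "\<tau> = (\<lambda>i x. if i = 2 then (b * \<rho> * indicator {- Lm..<Lp} (x $ 1)) *\<^sub>R axis 3 1 else 0)"
    unfolding assms(4) by (simp only:)
  then interpret dislocation_array "- Lm" Lp "b * \<rho>" \<tau> \<theta>
    using assms(1,2,5) by unfold_locales auto
  show ?thesis
    using weitzenboeck_torsion levi_civita_\<omega>\<^sub>0 curvature_pair by blast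
qed

end
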